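(* Let $K$ be a closed strongly connected $n$-dimensional pseudo-manifold. Then (i) the barycentric subdivision $\mathrm{Sd}(K)$ carries a Morse shelling, and (ii) after finitely many stellar subdivisions at facets (alternatively at ridges, or each at a facet or a ridge) $K$ carries a shellable $h$-tiling, where in both cases the tiling can be chosen to use exactly one closed simplex, at least one open simplex, and no other tile of order zero.
   Context: A closed $n$-dimensional pseudo-manifold is a finite simplicial complex whose maximal simplices (facets) all have dimension $n$ and whose $(n-1)$-faces (ridges) each lie in exactly two facets; it is strongly connected if any two facets can be joined by a sequence of facets, consecutive ones meeting along a ridge. A relative simplex is a simplex deprived of some proper faces. A basic tile of dimension $n$ and order $k\in\{0,\dots,n+1\}$ is an $n$-simplex deprived of $k$ ridges; it has a unique face of least dimension $k-1$. A critical tile of index $k\in\{0,\dots,n\}$ is a basic tile of order $k$ deprived moreover of that face. A Morse tile of order $k$ is an $n$-simplex deprived of $k$ ridges together with possibly one further face of codimension at least two not contained in the removed ridges. A tiling of $K$ is a partition of $|K|$ into relative simplices with underlying simplices in $K$ such that for every $d\ge0$ the union of tiles of dimension $>d$ is closed; it is shellable if its tiles can be ordered $T_1,\dots,T_N$ with each $T_1\cup\dots\cup T_p$ closed (a shelling). An $h$-tiling uses only basic or critical tiles; a Morse shelling is a shelling of a tiling by Morse tiles. Stellar subdivision at a nonempty face $\tau$: remove simplices containing $\tau$, add a vertex $\hat\tau$ and all cones $\hat\tau*\rho$, $\rho$ ranging over faces not containing $\tau$ of simplices containing $\tau$. $\mathrm{Sd}(K)$ is the complex of chains of nonempty simplices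 of $K$. *)

theory Defs
  imports "HOL-Analysis.Analysis" "HOL-Library.Disjoint_Sets"
begin

section \<open>Finite simplicial complexes\<close>

text \<open>
  Simplices are the nonempty finite sets of their vertices, so the empty simplex is not a member
  of a complex, and a simplex \<open>\<sigma>\<close> has dimension \<open>card \<sigma> - 1\<close>.
\<close>

definition simplicial_cpx :: "'a set set \<Rightarrow> bool" where
  "simplicial_cpx K \<longleftrightarrow> finite K \<and> (\<forall>\<sigma>\<in>K. finite \<sigma> \<and> \<sigma> \<noteq> {}) \<and>
     (\<forall>\<sigma>\<in>K. \<forall>\<tau>. \<tau> \<noteq> {} \<and> \<tau> \<subseteq> \<sigma> \<longrightarrow> \<tau> \<in> K)"

definition facets :: "'a set set \<Rightarrow> 'a set set" where
  "facets K = {\<sigma> \<in> K. \<forall>\<tau>\<in>K. \<sigma> \<subseteq> \<tau> \<longrightarrow> \<tau> = \<sigma>}"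

text \<open>The simplices of dimension \<open>n - 1\<close>.\<close>

definition ridges :: "nat \<Rightarrow> 'a set set \<Rightarrow> 'a set set" where
  "ridges n K = {\<rho> \<in> K. card \<rho> = n}"

definition closed_pseudo_manifold :: "nat \<Rightarrow> 'a set set \<Rightarrow> bool" where
  "closed_pseudo_manifold n K \<longleftrightarrow> simplicial_cpx K \<and> K \<noteq> {} \<and>
     (\<forall>\<sigma>\<in>facets K. card \<sigma> = n + 1) \<and>
     (\<forall>\<rho>\<in>ridges n K. card {\<sigma> \<in> facets K. \<rho> \<subseteq> \<sigma>} = 2)"

definition strongly_connected :: "nat \<Rightarrow> 'a set set \<Rightarrow> bool" where
  "strongly_connected n K \<longleftrightarrow>
     (\<forall>\<sigma>\<in>facets K. \<forall>\<tau>\<in>facets K.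
        (\<lambda>\<alpha> \<beta>. \<alpha> \<in> facets K \<and> \<beta> \<in> facets K \<and> \<alpha> \<inter> \<beta> \<in> ridges n K)\<^sup>*\<^sup>* \<sigma> \<tau>)"

definition Sd :: "'a set set \<Rightarrow> 'a set set set" where
  "Sd K = {c. c \<noteq> {} \<and> subset.chain K c}"

text \<open>
  Stellar subdivision at \<open>\<tau>\<close> with new vertex \<open>v\<close>. As \<open>\<tau>\<close> is nonempty, \<open>\<rho> = {}\<close> is
  among the bases of the cones and contributes the new vertex itself.
\<close>

definition stellar :: "'a set set \<Rightarrow> 'a set \<Rightarrow> 'a \<Rightarrow> 'a set set" where
  "stellar K \<tau> v = {\<sigma> \<in> K. \<not> \<tau> \<subseteq> \<sigma>} \<union>
     {insert v \<rho> | \<rho>. \<exists>\<sigma>\<in>K. \<tau> \<subseteq> \<sigma> \<and> \<rho> \<subseteq> \<sigma> \<and> \<not> \<tau> \<subseteq> \<rho>}"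

text \<open>\<open>F\<close> prescribes at which faces of a complex one may subdivide.\<close>

definition stellar_step :: "('a set set \<Rightarrow> 'a set set) \<Rightarrow> 'a set set \<Rightarrow> 'a set set \<Rightarrow> bool" where
  "stellar_step F K K' \<longleftrightarrow> (\<exists>\<tau>\<in>F K. \<exists>v. v \<notin> \<Union>K \<and> K' = stellar K \<tau> v)"

text \<open>
  An isomorphic copy of \<open>K\<close> over a vertex type which always has fresh vertices left, even if
  \<open>'a\<close> is finite.
\<close>

definition fresh_copy :: "'a set set \<Rightarrow> ('a + nat) set set" where
  "fresh_copy K = (\<lambda>\<sigma>. Inl ` \<sigma>) ` K"

section \<open>Geometric realization and tiles\<close>

text \<open>
  Points are given by their barycentric coordinates, and \<open>'a \<Rightarrow> real\<close> carries the product
  topology, which induces the usual topology on the realization of a finite complex.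
  Note that \<open>realize {} = {}\<close>.
\<close>

definition realize :: "'a set \<Rightarrow> ('a \<Rightarrow> real) set" where
  "realize \<sigma> = {x. (\<forall>v. 0 \<le> x v) \<and> (\<forall>v. v \<notin> \<sigma> \<longrightarrow> x v = 0) \<and> (\<Sum>v\<in>\<sigma>. x v) = 1}"

definition realization :: "'a set set \<Rightarrow> ('a \<Rightarrow> real) set" where
  "realization K = (\<Union>\<sigma>\<in>K. realize \<sigma>)"

definition deprived :: "'a set \<Rightarrow> 'a set set \<Rightarrow> ('a \<Rightarrow> real) set" where
  "deprived \<sigma> R = realize \<sigma> - (\<Union>\<rho>\<in>R. realize \<rho>)"

definition relative_simplex :: "'a set \<Rightarrow> ('a \<Rightarrow> real) set \<Rightarrow> bool" where
  "relative_simplex \<sigma> T \<longleftrightarrow> finite \<sigma> \<and> \<sigma> \<noteq> {} \<and> (\<exists>R. (\<forall>\<rho>\<in>R. \<rho> \<subset> \<sigma>) \<and> T = deprived \<sigma> R)"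

definition simplex_ridges :: "'a set \<Rightarrow> 'a set set" where
  "simplex_ridges \<sigma> = {\<rho>. \<rho> \<subseteq> \<sigma> \<and> card \<rho> + 1 = card \<sigma>}"

text \<open>
  In the three notions below \<open>\<sigma>\<close> is the underlying simplex and \<open>k\<close> the order.
\<close>

definition basic_tile :: "'a set \<Rightarrow> nat \<Rightarrow> ('a \<Rightarrow> real) set \<Rightarrow> bool" where
  "basic_tile \<sigma> k T \<longleftrightarrow> finite \<sigma> \<and> \<sigma> \<noteq> {} \<and>
     (\<exists>R \<subseteq> simplex_ridges \<sigma>. card R = k \<and> T = deprived \<sigma> R)"

text \<open>
  The face of least dimension \<open>\<mu>\<close> of the basic tile is the set of the \<open>k\<close> vertices opposite
  to the removed ridges; for \<open>k = 0\<close> it is the empty face and the tile is the closed simplex.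
\<close>

definition critical_tile :: "'a set \<Rightarrow> nat \<Rightarrow> ('a \<Rightarrow> real) set \<Rightarrow> bool" where
  "critical_tile \<sigma> k T \<longleftrightarrow> finite \<sigma> \<and> \<sigma> \<noteq> {} \<and> k < card \<sigma> \<and>
     (\<exists>R \<subseteq> simplex_ridges \<sigma>. card R = k \<and>
       (\<exists>\<mu>. is_arg_min card (\<lambda>\<tau>. \<tau> \<subseteq> \<sigma> \<and> (\<forall>\<rho>\<in>R. \<not> \<tau> \<subseteq> \<rho>)) \<mu> \<and>
         T = deprived \<sigma> (insert \<mu> R)))"

definition morse_tile :: "'a set \<Rightarrow> nat \<Rightarrow> ('a \<Rightarrow> real) set \<Rightarrow> bool" where
  "morse_tile \<sigma> k T \<longleftrightarrow> finite \<sigma> \<and> \<sigma> \<noteq> {} \<and>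
     (\<exists>R \<subseteq> simplex_ridges \<sigma>. card R = k \<and>
       (T = deprived \<sigma> R \<or>
        (\<exists>\<mu>. \<mu> \<subseteq> \<sigma> \<and> card \<mu> + 2 \<le> card \<sigma> \<and> (\<forall>\<rho>\<in>R. \<not> \<mu> \<subseteq> \<rho>) \<and>
           T = deprived \<sigma> (insert \<mu> R))))"

definition h_tile :: "'a set \<Rightarrow> nat \<Rightarrow> ('a \<Rightarrow> real) set \<Rightarrow> bool" where
  "h_tile \<sigma> k T \<longleftrightarrow> basic_tile \<sigma> k T \<or> critical_tile \<sigma> k T"

definition closed_simplex :: "('a \<Rightarrow> real) set \<Rightarrow> bool" where
  "closed_simplex T \<longleftrightarrow> (\<exists>\<sigma>. finite \<sigma> \<and> \<sigma> \<noteq> {} \<and> T = realize \<sigma>)"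

definition open_simplex :: "('a \<Rightarrow> real) set \<Rightarrow> bool" where
  "open_simplex T \<longleftrightarrow> (\<exists>\<sigma>. finite \<sigma> \<and> \<sigma> \<noteq> {} \<and> T = deprived \<sigma> {\<rho>. \<rho> \<subset> \<sigma>})"

section \<open>Tilings and shellings\<close>

definition tiling :: "'a set set \<Rightarrow> ('a \<Rightarrow> real) set set \<Rightarrow> bool" where
  "tiling K \<T> \<longleftrightarrow> partition_on (realization K) \<T> \<and>
     (\<forall>T\<in>\<T>. \<exists>\<sigma>\<in>K. relative_simplex \<sigma> T) \<and>
     (\<forall>d. closedin (top_of_set (realization K))
        (\<Union>{T\<in>\<T>. \<exists>\<sigma>. relative_simplex \<sigma> T \<and> d < card \<sigma> - 1}))"

definition shelling :: "'a set set \<Rightarrow> ('a \<Rightarrow> real) set list \<Rightarrow> bool" where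
  "shelling K Ts \<longleftrightarrow> distinct Ts \<and> tiling K (set Ts) \<and>
     (\<forall>p \<le> length Ts. closedin (top_of_set (realization K)) (\<Union>(set (take p Ts))))"

text \<open>
  \<open>tile\<close> is the kind of tiles allowed, with arguments as in \<open>morse_tile\<close>: all tiles of the shelling
  are of this kind, exactly one is a closed simplex, at least one is an open simplex, and those
  of order zero are closed simplices.
\<close>

definition carries_shelling ::
  "('a set \<Rightarrow> nat \<Rightarrow> ('a \<Rightarrow> real) set \<Rightarrow> bool) \<Rightarrow> 'a set set \<Rightarrow> bool" where
  "carries_shelling tile K \<longleftrightarrow> (\<exists>Ts. shelling K Ts \<and>
     (\<forall>T\<in>set Ts. \<exists>\<sigma> k. tile \<sigma> k T) \<and>
     (\<exists>!T. T \<in> set Ts \<and> closed_simplex T) \<and>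
     (\<exists>T\<in>set Ts. open_simplex T) \<and>
     (\<forall>T\<in>set Ts. \<forall>\<sigma>. tile \<sigma> 0 T \<longrightarrow> closed_simplex T))"

end

theory Submission
  imports Defs "HOL-Library.List_Lexorder"
begin

text \<open>
  In a shelling by top-dimensional tiles the \<open>p\<close>-th tile is the \<open>p\<close>-th facet deprived of all the
  previous ones, so everything reduces to ordering facets. Strong connectedness orders the facets
  of \<open>K\<close> so that each but the first shares a ridge with an earlier one; no later tile is then
  closed, and the last tile is open because every ridge lies in two facets.

  In \<open>Sd K\<close>, order the chambers of each facet lexicographically. The earlier chambers in the same
  facet meet a chamber in ridges, one per descent, and those in earlier facets meet it in the single
  face of all its vertices lying in earlier facets. The vertices of each facet are labelled so that
  the chamber without descents also meets the earlier ones in a ridge.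

  For \<open>h\<close>-tilings, subdividing at a facet, or at a well-chosen ridge, whose tile is neither basic
  nor critical replaces it by tiles with a strictly smaller set \<open>ext\<close>, if the new facets are
  suitably ordered; weighting each facet exponentially in \<open>card ext\<close> gives a decreasing cost.
\<close>

section \<open>Realizations and tiles\<close>

text \<open>Covering, disjointness and closedness hold for every order of the facets; only the types
  of the tiles depend on it. The type is decided by the faces already covered: the ridges recorded
  by \<open>opp\<close>, and the traces of those earlier facets that contain the whole face
  \<open>opp\<close>. These traces need not lie in one admissible face, which is the obstacle in
  both halves. In \<open>Sd K\<close> it disappears: the members of a flag lying in earlier facets
  form an initial segment, and a facet containing the largest of them contains them all, so one
  earlier chamber covers the whole segment. Under stellar subdivision it is removed gradually. It
  matters that \<tau> has codimension at most one: two facets containing \<tau> then coincide or are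
  adjacent across \<tau>, so the least face of a new tile lies in no new facet placed earlier, and
  no new vertex enters \<open>ext\<close>. A vertex is lost when \<tau> meets \<open>ext\<close>. A
  ridge lies in several facets, none of which may become worse, and this dictates its choice.
  Dimension zero stands apart: the ridge of a point is the empty face, whose removal changes
  nothing.\<close>

definition generated :: "'a set set \<Rightarrow> 'a set set" where
  "generated \<F> = {s. s \<noteq> {} \<and> (\<exists>F\<in>\<F>. s \<subseteq> F)}"

lemma generatedI: "F \<in> \<F> \<Longrightarrow> s \<subseteq> F \<Longrightarrow> s \<noteq> {} \<Longrightarrow> s \<in> generated \<F>"
  by (auto simp: generated_def)

lemma generatedE:
  assumes "s \<in> generated \<F>"
  obtains F where "F \<in> \<F>" "s \<subseteq> F" "s \<noteq> {}"
  using assms by (auto simp: generated_def)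

text \<open>
  If \<open>P\<close> are the facets preceding \<open>\<sigma>\<close>, then \<open>opp P \<sigma>\<close> are the vertices opposite to the ridges
  removed from \<open>\<sigma>\<close>, that is the least face of the basic tile, and \<open>ext P \<sigma>\<close> are the vertices by
  which that face extends to a larger face already covered. The tile is basic or critical if and
  only if \<open>ext P \<sigma>\<close> is empty.
\<close>

definition opp :: "'a set set \<Rightarrow> 'a set \<Rightarrow> 'a set" where
  "opp P \<sigma> = {w \<in> \<sigma>. \<exists>F\<in>P. \<sigma> - {w} \<subseteq> F}"

definition ext :: "'a set set \<Rightarrow> 'a set \<Rightarrow> 'a set" where
  "ext P \<sigma> = {w \<in> \<sigma> - opp P \<sigma>. \<exists>F\<in>P. insert w (opp P \<sigma>) \<subseteq> F}"

lemma oppI: "w \<in> \<sigma> \<Longrightarrow> F \<in> P \<Longrightarrow> \<sigma> - {w} \<subseteq> F \<Longrightarrow> w \<in> opp P \<sigma>"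
  by (auto simp: opp_def)

lemma oppE:
  assumes "w \<in> opp P \<sigma>"
  obtains F where "w \<in> \<sigma>" "F \<in> P" "\<sigma> - {w} \<subseteq> F"
  using assms by (auto simp: opp_def)

lemma extI:
  "w \<in> \<sigma> \<Longrightarrow> w \<notin> opp P \<sigma> \<Longrightarrow> F \<in> P \<Longrightarrow> insert w (opp P \<sigma>) \<subseteq> F \<Longrightarrow> w \<in> ext P \<sigma>"
  by (auto simp: ext_def)

lemma extE:
  assumes "w \<in> ext P \<sigma>"
  obtains F where "w \<in> \<sigma>" "w \<notin> opp P \<sigma>" "F \<in> P" "insert w (opp P \<sigma>) \<subseteq> F"
  using assms by (auto simp: ext_def)

lemma opp_subset: "opp P \<sigma> \<subseteq> \<sigma>"
  by (auto simp: opp_def)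

lemma finite_ext: "finite \<sigma> \<Longrightarrow> finite (ext P \<sigma>)"
  by (auto simp: ext_def)

definition supp :: "('a \<Rightarrow> real) \<Rightarrow> 'a set" where
  "supp x = {v. x v \<noteq> 0}"

text \<open>Nonnegativity and the total mass on the support do not mention \<sigma>. For a point of
  some simplex, lying in another one is thus mere containment of the support, and statements about
  tiles become statements about finite sets.\<close>

lemma realize_iff_supp:
  assumes "finite \<sigma>"
  shows "x \<in> realize \<sigma> \<longleftrightarrow> (\<forall>v. 0 \<le> x v) \<and> supp x \<subseteq> \<sigma> \<and> sum x (supp x) = 1"
proof -
  have "sum x \<sigma> = sum x (supp x)" if "supp x \<subseteq> \<sigma>"
    using that assms by (intro sum.mono_neutral_right) (auto simp: supp_def)
  moreover have "(\<forall>v. v \<notin> \<sigma> \<longrightarrow> x v = 0) \<longleftrightarrow> supp x \<subseteq> \<sigma>" by (auto simp: supp_def)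
  ultimately show ?thesis by (auto simp: realize_def)
qed

lemma supp_realize:
  assumes "finite \<sigma>" "x \<in> realize \<sigma>"
  shows "supp x \<subseteq> \<sigma>" "supp x \<noteq> {}"
  using assms by (auto simp: realize_iff_supp)

lemma deprived_iff_supp:
  assumes "finite \<sigma>" "\<And>\<rho>. \<rho> \<in> R \<Longrightarrow> finite \<rho>"
  shows "x \<in> deprived \<sigma> R \<longleftrightarrow> x \<in> realize \<sigma> \<and> (\<forall>\<rho>\<in>R. \<not> supp x \<subseteq> \<rho>)"
  using assms by (auto simp: deprived_def realize_iff_supp)

lemma ex_realize_supp:
  assumes "finite s" "s \<noteq> {}"
  obtains x where "x \<in> realize s" "supp x = s"
proof
  let ?x = "\<lambda>v. if v \<in> s then 1 / real (card s) else 0"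
  show "supp ?x = s" using assms by (auto simp: supp_def)
  show "?x \<in> realize s" using assms by (auto simp: realize_def)
qed

lemma realize_mono: "finite \<sigma> \<Longrightarrow> \<rho> \<subseteq> \<sigma> \<Longrightarrow> realize \<rho> \<subseteq> realize \<sigma>"
  using realize_iff_supp[of \<rho>] realize_iff_supp[of \<sigma>] finite_subset[of \<rho> \<sigma>] by blast

text \<open>A point of \<sigma> lies in exactly those removed simplices that contain its support, so
  only the nonempty faces they cover matter. This allows earlier facets, which are not faces of
  \<sigma>, to be traded for faces of \<sigma>.\<close>

lemma deprived_cong:
  assumes "finite \<sigma>" "\<And>\<rho>. \<rho> \<in> R \<Longrightarrow> finite \<rho>" "\<And>\<rho>. \<rho> \<in> R' \<Longrightarrow> finite \<rho>"
    and "\<And>s. s \<subseteq> \<sigma> \<Longrightarrow> s \<noteq> {} \<Longrightarrow> (\<exists>\<rho>\<in>R. s \<subseteq> \<rho>) \<longleftrightarrow> (\<exists>\<rho>\<in>R'. s \<subseteq> \<rho>)"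
  shows "deprived \<sigma> R = deprived \<sigma> R'"
proof (rule set_eqI)
  fix x
  show "x \<in> deprived \<sigma> R \<longleftrightarrow> x \<in> deprived \<sigma> R'"
    using assms(4)[of "supp x"] supp_realize[OF assms(1), of x]
    by (auto simp: deprived_iff_supp[OF assms(1,2)] deprived_iff_supp[OF assms(1,3)])
qed

lemma closed_realize: "closed (realize \<sigma>)"
proof -
  have *: "continuous_on UNIV (\<lambda>x :: 'a \<Rightarrow> real. x v)" for v :: 'a
    by (rule continuous_on_product_coordinates)
  have "realize \<sigma> = (\<Inter>v. {x. 0 \<le> x v}) \<inter> (\<Inter>v\<in>-\<sigma>. {x. x v = 0}) \<inter> {x. (\<Sum>v\<in>\<sigma>. x v) = 1}"
    by (auto simp: realize_def)
  also have "closed \<dots>"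
    by (intro closed_Int closed_INT ballI closed_Collect_le closed_Collect_eq
        continuous_on_const continuous_on_sum *)
  finally show ?thesis .
qed

lemma finite_simplex_ridges: "finite \<sigma> \<Longrightarrow> finite (simplex_ridges \<sigma>)"
  by (auto simp: simplex_ridges_def)

text \<open>A point with full support survives the removal of any proper faces, so a tile determines
  its underlying simplex. This tames the definitions that only assert the existence of such a
  simplex.\<close>

lemma relative_simplex_unique:
  assumes "relative_simplex \<sigma> T" "relative_simplex \<sigma>' T"
  shows "\<sigma> = \<sigma>'"
proof -
  have *: "\<sigma> \<subseteq> \<sigma>'" if "relative_simplex \<sigma> T" "relative_simplex \<sigma>' T" for \<sigma> \<sigma>' :: "'a set"
  proof -
    obtain R where R: "finite \<sigma>" "\<sigma> \<noteq> {}" "\<forall>\<rho>\<in>R. \<rho> \<subset> \<sigma>" "T = deprived \<sigma> R"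
      using \<open>relative_simplex \<sigma> T\<close> by (auto simp: relative_simplex_def)
    have fin: "finite \<rho>" if "\<rho> \<in> R" for \<rho>
      using R that by (auto intro: finite_subset)
    obtain x where x: "x \<in> realize \<sigma>" "supp x = \<sigma>"
      using ex_realize_supp R by blast
    then have "x \<in> T" using R fin by (auto simp: deprived_iff_supp)
    then have "x \<in> realize \<sigma>'" "finite \<sigma>'"
      using \<open>relative_simplex \<sigma>' T\<close> by (auto simp: relative_simplex_def deprived_def)
    then show ?thesis using x supp_realize by blast
  qed
  show ?thesis using * assms by blast
qed

lemma realization_generated:
  assumes "\<And>F. F \<in> \<F> \<Longrightarrow> finite F \<and> F \<noteq> {}"
  shows "realization (generated \<F>) = (\<Union>F\<in>\<F>. realize F)"
proof (intro equalityI subsetI)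
  fix x assume "x \<in> realization (generated \<F>)"
  then obtain s F where "x \<in> realize s" "F \<in> \<F>" "s \<subseteq> F" by (auto simp: realization_def generated_def)
  then show "x \<in> (\<Union>F\<in>\<F>. realize F)" using assms realize_mono[of F s] by blast
next
  fix x assume "x \<in> (\<Union>F\<in>\<F>. realize F)"
  then show "x \<in> realization (generated \<F>)" using assms unfolding realization_def generated_def by blast
qed

text \<open>The traces on \<sigma> of the removed simplices are proper faces of \<sigma> and cover
  the same faces of it.\<close>

lemma relative_simplex_deprived:
  assumes "finite \<sigma>" "\<sigma> \<noteq> {}" "\<And>F. F \<in> P \<Longrightarrow> finite F \<and> \<not> \<sigma> \<subseteq> F"
  shows "relative_simplex \<sigma> (deprived \<sigma> P)"
proof -
  have "deprived \<sigma> P = deprived \<sigma> ((\<inter>) \<sigma> ` P)"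
    using assms by (intro deprived_cong) auto
  then show ?thesis using assms unfolding relative_simplex_def
    by (intro conjI exI[of _ "(\<inter>) \<sigma> ` P"]) auto
qed

section \<open>The tiles and the shelling obtained from an ordered list of facets\<close>

definition tiles_of :: "'a set list \<Rightarrow> ('a \<Rightarrow> real) set list" where
  "tiles_of Fs = map (\<lambda>p. deprived (Fs ! p) (set (take p Fs))) [0..<length Fs]"

text \<open>Each facet contributes what the earlier ones leave uncovered, so an initial union of
  tiles is a finite union of closed simplices. Both the covering property and the closedness
  required of a shelling rest on this.\<close>

lemma Union_deprived_take:
  "p \<le> length Fs \<Longrightarrow>
    (\<Union>q<p. deprived (Fs ! q) (set (take q Fs))) = (\<Union>F\<in>set (take p Fs). realize F)"
proof (induction p)
  case (Suc p)
  then show ?case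
    by (simp add: lessThan_Suc take_Suc_conv_app_nth deprived_def Un_commute)
qed simp

locale pure_list =
  fixes n :: nat and Fs :: "'a set list"
  assumes dist: "distinct Fs"
    and card_facet: "F \<in> set Fs \<Longrightarrow> card F = n + 1"
begin

lemma facet_finite: "F \<in> set Fs \<Longrightarrow> finite F" and facet_nonempty: "F \<in> set Fs \<Longrightarrow> F \<noteq> {}"
  using card_facet by (force intro: card_ge_0_finite)+

text \<open>Distinct sets of equal cardinality are incomparable, so no earlier facet swallows the
  interior of a later one.\<close>

lemma before:
  assumes "p < length Fs" "F \<in> set (take p Fs)"
  shows "F \<in> set Fs" "\<not> Fs ! p \<subseteq> F" "finite F"
proof -
  show F: "F \<in> set Fs" using assms by (meson in_set_takeD)
  then show "finite F" by (rule facet_finite)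
  obtain q where "q < p" "F = Fs ! q" using assms by (auto simp: in_set_conv_nth)
  then have "F \<noteq> Fs ! p" using assms dist by (simp add: nth_eq_iff_index_eq)
  then show "\<not> Fs ! p \<subseteq> F"
    using card_facet[OF F] card_facet[of "Fs ! p"] assms(1) \<open>finite F\<close> by (metis card_subset_eq nth_mem)
qed

abbreviation "tile p \<equiv> deprived (Fs ! p) (set (take p Fs))"

lemma relative_simplex_tile: "p < length Fs \<Longrightarrow> relative_simplex (Fs ! p) (tile p)"
  using before facet_finite facet_nonempty by (intro relative_simplex_deprived) auto

lemma face_in_tile:
  assumes "p < length Fs" "s \<subseteq> Fs ! p" "s \<noteq> {}" "\<And>F. F \<in> set (take p Fs) \<Longrightarrow> \<not> s \<subseteq> F"
  obtains x where "x \<in> tile p" "supp x = s"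
proof -
  have "finite (Fs ! p)" using assms facet_finite by simp
  then obtain x where "x \<in> realize s" "supp x = s"
    using ex_realize_supp[of s] assms finite_subset by metis
  moreover from this have "x \<in> tile p"
    using assms \<open>finite (Fs ! p)\<close> realize_mono[of "Fs ! p" s] before(3)[OF assms(1)]
    by (subst deprived_iff_supp) auto
  ultimately show thesis using that by blast
qed

lemma tile_disjoint:
  assumes "p < q" "q < length Fs"
  shows "tile p \<inter> tile q = {}"
proof -
  have "Fs ! p \<in> set (take q Fs)" using assms by (metis in_set_conv_nth length_take min.absorb4 nth_take)
  then show ?thesis by (auto simp: deprived_def)
qed

lemma tile_nonempty: "p < length Fs \<Longrightarrow> tile p \<noteq> {}"
  by (metis face_in_tile[of p "Fs ! p"] before(2)[of p] facet_nonempty[of "Fs ! p"] empty_iff nth_mem order_refl)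

lemma tile_inj: "inj_on tile {..<length Fs}"
proof (rule inj_onI)
  fix p q assume "p \<in> {..<length Fs}" "q \<in> {..<length Fs}" "tile p = tile q"
  then show "p = q"
    by (metis tile_disjoint tile_nonempty Int_absorb lessThan_iff neqE)
qed

lemma set_tiles_of: "set (tiles_of Fs) = tile ` {..<length Fs}"
  by (simp add: tiles_of_def atLeast0LessThan)

lemma take_tiles_of:
  assumes "p \<le> length Fs"
  shows "set (take p (tiles_of Fs)) = tile ` {..<p}"
proof -
  have "take p [0..<length Fs] = [0..<p]" using assms by (simp add: take_upt)
  then show ?thesis by (simp add: tiles_of_def take_map atLeast0LessThan)
qed

lemma realization_eq: "realization (generated (set Fs)) = (\<Union>F\<in>set Fs. realize F)"
  using facet_finite facet_nonempty by (intro realization_generated) auto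

lemma Union_tiles: "\<Union> (set (tiles_of Fs)) = realization (generated (set Fs))"
  using Union_deprived_take[of "length Fs" Fs] by (simp add: set_tiles_of realization_eq)

lemma tiling_tiles_of: "tiling (generated (set Fs)) (set (tiles_of Fs))"
  unfolding tiling_def
proof (intro conjI ballI allI)
  show "partition_on (realization (generated (set Fs))) (set (tiles_of Fs))"
  proof (rule partition_onI)
    fix S T assume "S \<in> set (tiles_of Fs)" "T \<in> set (tiles_of Fs)" "S \<noteq> T"
    then obtain p q where "p < length Fs" "q < length Fs" "S = tile p" "T = tile q" "p \<noteq> q"
      unfolding set_tiles_of by blast
    then show "disjnt S T"
      unfolding disjnt_def by (metis tile_disjoint Int_commute neqE)
  next
    show "\<Union> (set (tiles_of Fs)) = realization (generated (set Fs))" by (rule Union_tiles)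
  next
    show "{} \<notin> set (tiles_of Fs)" unfolding set_tiles_of using tile_nonempty by blast
  qed
next
  fix T assume "T \<in> set (tiles_of Fs)"
  then obtain p where "p < length Fs" "T = tile p" unfolding set_tiles_of by blast
  moreover from this have "Fs ! p \<in> generated (set Fs)"
    using facet_nonempty by (auto simp: generated_def)
  ultimately show "\<exists>\<sigma>\<in>generated (set Fs). relative_simplex \<sigma> T"
    using relative_simplex_tile by blast
next
  fix d
  \<comment> \<open>All underlying simplices have dimension \<open>n\<close>, so the union of the
    tiles of dimension above \<open>d\<close> is everything or nothing.\<close>
  have *: "(\<exists>\<sigma>. relative_simplex \<sigma> T \<and> d < card \<sigma> - 1) \<longleftrightarrow> d < n" if T: "T \<in> set (tiles_of Fs)" for T
  proof -
    obtain p where p: "p < length Fs" "T = tile p" using T unfolding set_tiles_of by blast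
    then show ?thesis
      using relative_simplex_tile[of p] relative_simplex_unique[of _ T "Fs ! p"] card_facet[of "Fs ! p"]
      by (metis add_diff_cancel_right' nth_mem)
  qed
  have "{T\<in>set (tiles_of Fs). \<exists>\<sigma>. relative_simplex \<sigma> T \<and> d < card \<sigma> - 1} =
      (if d < n then set (tiles_of Fs) else {})"
    using * by auto
  then have "\<Union>{T\<in>set (tiles_of Fs). \<exists>\<sigma>. relative_simplex \<sigma> T \<and> d < card \<sigma> - 1} =
      (if d < n then realization (generated (set Fs)) else {})"
    using Union_tiles by simp
  then show "closedin (top_of_set (realization (generated (set Fs))))
      (\<Union>{T\<in>set (tiles_of Fs). \<exists>\<sigma>. relative_simplex \<sigma> T \<and> d < card \<sigma> - 1})"
    by simp
qed

lemma shelling_tiles_of: "shelling (generated (set Fs)) (tiles_of Fs)"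
  unfolding shelling_def
proof (intro conjI allI impI tiling_tiles_of)
  show "distinct (tiles_of Fs)"
    using tile_inj by (simp add: tiles_of_def distinct_map atLeast0LessThan)
next
  fix p assume "p \<le> length (tiles_of Fs)"
  then have p: "p \<le> length Fs" by (simp add: tiles_of_def)
  have "\<Union>(set (take p (tiles_of Fs))) = (\<Union>F\<in>set (take p Fs). realize F)"
    using take_tiles_of[OF p] Union_deprived_take[OF p] by simp
  moreover have "closed (\<Union>F\<in>set (take p Fs). realize F)"
    by (intro closed_UN closed_realize ballI finite_set)
  moreover have "(\<Union>F\<in>set (take p Fs). realize F) \<subseteq> realization (generated (set Fs))"
    unfolding realization_eq using set_take_subset[of p Fs] by blast
  ultimately show "closedin (top_of_set (realization (generated (set Fs)))) (\<Union>(set (take p (tiles_of Fs))))"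
    using closed_subset by metis
qed

text \<open>A closed simplex equal to the tile would have to be the whole facet, but the ridge
  opposite to \<open>w\<close> is missing from the tile.\<close>

lemma not_closed_tile:
  assumes "p < length Fs" "w \<in> opp (set (take p Fs)) (Fs ! p)" "n > 0"
  shows "\<not> closed_simplex (tile p)"
proof
  assume "closed_simplex (tile p)"
  then obtain \<sigma> where \<sigma>: "finite \<sigma>" "\<sigma> \<noteq> {}" "tile p = realize \<sigma>" by (auto simp: closed_simplex_def)
  then have "relative_simplex \<sigma> (tile p)"
    by (auto simp: relative_simplex_def deprived_def intro!: exI[of _ "{}"])
  then have \<sigma>_eq: "\<sigma> = Fs ! p" using relative_simplex_tile relative_simplex_unique assms by metis
  obtain F where F: "F \<in> set (take p Fs)" "Fs ! p - {w} \<subseteq> F" "w \<in> Fs ! p" using assms by (auto simp: opp_def)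
  have "card (Fs ! p - {w}) = n" using card_facet[of "Fs ! p"] assms F by simp
  \<comment> \<open>Positive dimension enters here: the removed ridge has to contain a
    point.\<close>
  then have "Fs ! p - {w} \<noteq> {}" using assms(3) by force
  then obtain x where x: "x \<in> realize (Fs ! p - {w})" "supp x = Fs ! p - {w}"
    using ex_realize_supp facet_finite[of "Fs ! p"] assms by (metis finite_Diff nth_mem)
  then have "x \<in> realize \<sigma>" using realize_mono[OF \<sigma>(1), of "Fs ! p - {w}"] \<sigma>_eq by blast
  moreover have "x \<in> realize F"
    using x(1) F(2) realize_mono[OF before(3)[OF assms(1) F(1)]] by blast
  ultimately show False using \<sigma>(3) F by (auto simp: deprived_def)
qed

lemma open_tile:
  assumes "p < length Fs" "opp (set (take p Fs)) (Fs ! p) = Fs ! p"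
  shows "open_simplex (tile p)"
proof -
  have "finite (Fs ! p)" "Fs ! p \<noteq> {}" using assms facet_finite facet_nonempty by auto
  moreover have "tile p = deprived (Fs ! p) {\<rho>. \<rho> \<subset> Fs ! p}"
  proof (rule deprived_cong)
    fix s assume s: "s \<subseteq> Fs ! p" "s \<noteq> {}"
    show "(\<exists>\<rho>\<in>set (take p Fs). s \<subseteq> \<rho>) \<longleftrightarrow> (\<exists>\<rho>\<in>{\<rho>. \<rho> \<subset> Fs ! p}. s \<subseteq> \<rho>)"
    proof
      assume "\<exists>\<rho>\<in>set (take p Fs). s \<subseteq> \<rho>"
      then have "s \<subset> Fs ! p" using s before(2)[OF assms(1)] by auto
      then show "\<exists>\<rho>\<in>{\<rho>. \<rho> \<subset> Fs ! p}. s \<subseteq> \<rho>" by blast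
    next
      assume "\<exists>\<rho>\<in>{\<rho>. \<rho> \<subset> Fs ! p}. s \<subseteq> \<rho>"
      then obtain w where w: "w \<in> Fs ! p" "s \<subseteq> Fs ! p - {w}" by blast
      then have "w \<in> opp (set (take p Fs)) (Fs ! p)" using assms(2) by simp
      then obtain F where "F \<in> set (take p Fs)" "Fs ! p - {w} \<subseteq> F"
        unfolding opp_def by blast
      with w show "\<exists>\<rho>\<in>set (take p Fs). s \<subseteq> \<rho>" by blast
    qed
  next
    show "finite \<rho>" if "\<rho> \<in> {\<rho>. \<rho> \<subset> Fs ! p}" for \<rho>
      using that \<open>finite (Fs ! p)\<close> finite_subset by blast
  qed (use before(3)[OF assms(1)] \<open>finite (Fs ! p)\<close> in simp_all)
  ultimately show ?thesis unfolding open_simplex_def by blast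
qed

text \<open>The criterion shared by both halves. Every tile but the first lacks a ridge, whereas a
  Morse tile of order zero lacks at most one face of codimension at least two; hence a tile of order
  zero is closed, and only the first tile is a closed simplex.\<close>

lemma carries_shelling_generated:
  assumes "Fs \<noteq> []"
    and tile_kind: "\<And>p. p < length Fs \<Longrightarrow> \<exists>k. kind (Fs ! p) k (tile p)"
    and ridge: "\<And>p. p < length Fs \<Longrightarrow> 0 < p \<Longrightarrow> 0 < n \<and> opp (set (take p Fs)) (Fs ! p) \<noteq> {}"
    and open_tile: "\<exists>p<length Fs. open_simplex (tile p)"
    and zero: "\<And>\<sigma> T. kind \<sigma> 0 T \<Longrightarrow> morse_tile \<sigma> 0 T"
  shows "carries_shelling kind (generated (set Fs))"
proof -
  have pos: "0 < length Fs" using assms by simp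
  have first: "closed_simplex (tile 0)"
    using facet_finite[of "Fs ! 0"] facet_nonempty[of "Fs ! 0"] pos
    by (auto simp: closed_simplex_def deprived_def)
  have not_closed: "\<not> closed_simplex (tile p)" if "p < length Fs" "0 < p" for p
    using not_closed_tile ridge that by blast
  have closed: "closed_simplex T" if T: "T \<in> set (tiles_of Fs)" and kind: "kind \<sigma> 0 T" for T \<sigma>
  proof -
    obtain p where p: "p < length Fs" "T = tile p" using T unfolding set_tiles_of by blast
    show ?thesis
    proof (cases "p = 0")
      case True
      then show ?thesis using p first by simp
    next
      case False
      have m: "morse_tile \<sigma> 0 T" using zero kind by blast
      then obtain R where \<sigma>: "finite \<sigma>" "\<sigma> \<noteq> {}" and R: "R \<subseteq> simplex_ridges \<sigma>" "card R = 0"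
        "T = deprived \<sigma> R \<or>
        (\<exists>\<mu>. \<mu> \<subseteq> \<sigma> \<and> card \<mu> + 2 \<le> card \<sigma> \<and> (\<forall>\<rho>\<in>R. \<not> \<mu> \<subseteq> \<rho>) \<and>
           T = deprived \<sigma> (insert \<mu> R))"
        by (auto simp: morse_tile_def)
      have "finite R" using R(1) \<sigma> finite_simplex_ridges finite_subset by blast
      then have "R = {}" using R by simp
      then consider "T = realize \<sigma>" | \<mu> where "\<mu> \<subseteq> \<sigma>" "card \<mu> + 2 \<le> card \<sigma>" "T = deprived \<sigma> {\<mu>}"
        using R by (auto simp: deprived_def)
      then show ?thesis
      proof cases
        case 1
        then show ?thesis using \<sigma> by (auto simp: closed_simplex_def)
      next
        case 2
        then have "\<mu> \<subset> \<sigma>" by auto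
        then have "relative_simplex \<sigma> T" using 2 \<sigma> by (auto simp: relative_simplex_def intro!: exI[of _ "{\<mu>}"])
        then have \<sigma>_eq: "\<sigma> = Fs ! p" using relative_simplex_tile relative_simplex_unique p by metis
        obtain w F where F: "F \<in> set (take p Fs)" "\<sigma> - {w} \<subseteq> F" "w \<in> \<sigma>"
          using ridge[of p] p False \<sigma>_eq by (auto simp: opp_def)
        have c: "card (\<sigma> - {w}) = n" using card_facet[of \<sigma>] \<sigma>_eq p F by simp
        then have "\<sigma> - {w} \<noteq> {}" using ridge[of p] p False by force
        then obtain x where x: "x \<in> realize (\<sigma> - {w})" "supp x = \<sigma> - {w}"
          using ex_realize_supp \<sigma> by (metis finite_Diff)
        have "finite \<mu>" using 2 \<sigma> finite_subset by blast
        \<comment> \<open>The ridge is too large to lie in the single removed face \<mu>, so the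
          point \<open>x\<close> with the ridge as support stays in \<open>T\<close>, although it
          belongs to the earlier facet \<open>F\<close>.\<close>
        then have "\<not> \<sigma> - {w} \<subseteq> \<mu>"
          using card_mono[of \<mu> "\<sigma> - {w}"] c 2 F \<sigma> by (auto simp: card_Diff_singleton)
        then have "x \<notin> realize \<mu>" using x(2) supp_realize(1)[OF \<open>finite \<mu>\<close>] by blast
        then have "x \<in> T" using x(1) 2(3) realize_mono[OF \<sigma>(1), of "\<sigma> - {w}"] by (auto simp: deprived_def)
        moreover have "x \<in> realize F" using x(1) F(2) realize_mono[OF before(3)[OF p(1) F(1)]] by blast
        ultimately show ?thesis using F p by (auto simp: deprived_def)
      qed
    qed
  qed
  have "\<exists>!T. T \<in> set (tiles_of Fs) \<and> closed_simplex T"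
  proof (rule ex1I[of _ "tile 0"])
    show "tile 0 \<in> set (tiles_of Fs) \<and> closed_simplex (tile 0)"
      using first pos unfolding set_tiles_of by blast
  next
    fix T assume "T \<in> set (tiles_of Fs) \<and> closed_simplex T"
    then obtain p where "p < length Fs" "T = tile p" "closed_simplex T" unfolding set_tiles_of by blast
    then show "T = tile 0" using not_closed by (cases p) auto
  qed
  moreover have "\<exists>T\<in>set (tiles_of Fs). open_simplex T" using open_tile unfolding set_tiles_of by blast
  moreover have "\<forall>T\<in>set (tiles_of Fs). \<exists>\<sigma> k. kind \<sigma> k T"
    using tile_kind unfolding set_tiles_of by blast
  ultimately show ?thesis
    using shelling_tiles_of closed unfolding carries_shelling_def by blast
qed

end

text \<open>With no ridge removed, the least face is the empty one, whose realization is empty. A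
  critical tile of index zero is therefore a closed simplex too.\<close>

lemma h_tile_zero:
  assumes "h_tile \<sigma> 0 T"
  shows "morse_tile \<sigma> 0 T"
proof -
  have fin: "finite \<sigma>" "\<sigma> \<noteq> {}" using assms by (auto simp: h_tile_def basic_tile_def critical_tile_def)
  have "\<exists>R\<subseteq>simplex_ridges \<sigma>. card R = 0 \<and> T = deprived \<sigma> R"
    using assms unfolding h_tile_def
  proof
    assume "critical_tile \<sigma> 0 T"
    then obtain R \<mu> where R: "R \<subseteq> simplex_ridges \<sigma>" "card R = 0"
      and \<mu>: "is_arg_min card (\<lambda>\<tau>. \<tau> \<subseteq> \<sigma> \<and> (\<forall>\<rho>\<in>R. \<not> \<tau> \<subseteq> \<rho>)) \<mu>"
      and T: "T = deprived \<sigma> (insert \<mu> R)" by (auto simp: critical_tile_def)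
    have "finite R" using R(1) fin finite_simplex_ridges finite_subset by blast
    then have [simp]: "R = {}" using R by simp
    have "card \<mu> = 0" "\<mu> \<subseteq> \<sigma>" using \<mu> by (auto simp: is_arg_min_def)
    then have "\<mu> = {}" using fin finite_subset by fastforce
    then have "T = deprived \<sigma> {}" using T by (simp add: deprived_def realize_def)
    then show ?thesis by (intro exI[of _ "{}"]) auto
  qed (auto simp: basic_tile_def)
  then show ?thesis using fin by (auto simp: morse_tile_def)
qed

section \<open>Recognizing the type of a tile from the faces already covered\<close>

lemma opp_ridges:
  assumes "finite \<sigma>" "\<sigma> \<noteq> {}" "O' \<subseteq> \<sigma>"
  shows "(\<lambda>w. \<sigma> - {w}) ` O' \<subseteq> simplex_ridges \<sigma>" "card ((\<lambda>w. \<sigma> - {w}) ` O') = card O'"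
proof -
  show "(\<lambda>w. \<sigma> - {w}) ` O' \<subseteq> simplex_ridges \<sigma>"
    using assms card_Suc_Diff1[OF assms(1)] by (auto simp: simplex_ridges_def simp del: card_Diff_insert)
  have "inj_on (\<lambda>w. \<sigma> - {w}) O'" using assms by (auto simp: inj_on_def)
  then show "card ((\<lambda>w. \<sigma> - {w}) ` O') = card O'" by (rule card_image)
qed

text \<open>A facet of \<open>P\<close> missing a vertex of \<open>opp P \<sigma>\<close> meets
  \<sigma> inside the ridge opposite to that vertex; the others are accounted for by
  \<open>M\<close>. It is applied with \<open>M\<close> empty or with a single face, which gives the
  basic tiles on the one hand and the critical and Morse tiles on the other.\<close>

lemma deprived_opp:
  assumes fin: "finite \<sigma>" "\<And>F. F \<in> P \<Longrightarrow> finite F"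
    and M: "\<And>\<mu>. \<mu> \<in> M \<Longrightarrow> \<mu> \<subseteq> \<sigma> \<and> (\<exists>G\<in>P. \<mu> \<subseteq> G)"
    and face: "\<And>F. F \<in> P \<Longrightarrow> opp P \<sigma> \<subseteq> F \<Longrightarrow> \<sigma> \<inter> F \<noteq> {} \<Longrightarrow> \<exists>\<mu>\<in>M. \<sigma> \<inter> F \<subseteq> \<mu>"
  shows "deprived \<sigma> P = deprived \<sigma> (M \<union> (\<lambda>w. \<sigma> - {w}) ` opp P \<sigma>)" (is "_ = deprived \<sigma> ?Q")
proof (rule deprived_cong)
  fix \<rho> assume "\<rho> \<in> ?Q"
  then have "\<rho> \<subseteq> \<sigma>" using M by blast
  then show "finite \<rho>" using fin(1) by (rule finite_subset)
next
  fix s assume s: "s \<subseteq> \<sigma>" "s \<noteq> {}"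
  show "(\<exists>\<rho>\<in>P. s \<subseteq> \<rho>) \<longleftrightarrow> (\<exists>\<rho>\<in>?Q. s \<subseteq> \<rho>)"
  proof
    assume "\<exists>\<rho>\<in>P. s \<subseteq> \<rho>"
    then obtain F where F: "F \<in> P" "s \<subseteq> F" by blast
    show "\<exists>\<rho>\<in>?Q. s \<subseteq> \<rho>"
    proof (cases "opp P \<sigma> \<subseteq> F")
      case True
      have "s \<subseteq> \<sigma> \<inter> F" "\<sigma> \<inter> F \<noteq> {}" using F s by auto
      then obtain \<mu> where "\<mu> \<in> M" "s \<subseteq> \<mu>" using face[OF F(1) True] by (meson subset_trans)
      then show ?thesis by blast
    next
      case False
      then obtain w where "w \<in> opp P \<sigma>" "s \<subseteq> \<sigma> - {w}" using F s by auto
      then show ?thesis by blast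
    qed
  next
    assume "\<exists>\<rho>\<in>?Q. s \<subseteq> \<rho>"
    then consider \<mu> where "\<mu> \<in> M" "s \<subseteq> \<mu>" | w where "w \<in> opp P \<sigma>" "s \<subseteq> \<sigma> - {w}" by blast
    then show "\<exists>\<rho>\<in>P. s \<subseteq> \<rho>"
    proof cases
      case 1
      then show ?thesis using M by (meson subset_trans)
    next
      case 2
      then show ?thesis unfolding opp_def by (auto intro: subset_trans)
    qed
  qed
qed (use fin in auto)

text \<open>If no further vertex extends \<open>opp P \<sigma>\<close> to a covered face, a facet
  containing \<open>opp P \<sigma>\<close> meets \<sigma> in exactly that face. The tile is critical
  if such a facet exists and basic otherwise.\<close>

lemma ext_empty_h_tile:
  assumes fin: "finite \<sigma>" "\<sigma> \<noteq> {}" and P: "\<And>F. F \<in> P \<Longrightarrow> finite F \<and> \<not> \<sigma> \<subseteq> F" and ext: "ext P \<sigma> = {}"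
  shows "\<exists>k. h_tile \<sigma> k (deprived \<sigma> P)"
proof -
  let ?O = "opp P \<sigma>"
  let ?R = "(\<lambda>w. \<sigma> - {w}) ` ?O"
  note R = opp_ridges[OF fin opp_subset]
  have meet: "\<sigma> \<inter> F \<subseteq> ?O" if "F \<in> P" "?O \<subseteq> F" for F
  proof
    fix w assume "w \<in> \<sigma> \<inter> F"
    then show "w \<in> ?O" using ext that unfolding ext_def by blast
  qed
  show ?thesis
  proof (cases "\<exists>F\<in>P. ?O \<subseteq> F")
    case True
    then obtain G where G: "G \<in> P" "?O \<subseteq> G" by blast
    have "deprived \<sigma> P = deprived \<sigma> ({?O} \<union> ?R)"
      using fin P meet G opp_subset[of P \<sigma>] by (intro deprived_opp) auto
    \<comment> \<open>A face of \<sigma> avoids all ridges of \<open>?R\<close> precisely when it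
      contains \<open>?O\<close>, which is thus the smallest one.\<close>
    moreover have "is_arg_min card (\<lambda>\<tau>. \<tau> \<subseteq> \<sigma> \<and> (\<forall>\<rho>\<in>?R. \<not> \<tau> \<subseteq> \<rho>)) ?O"
    proof -
      have "card ?O \<le> card \<tau>" if "\<tau> \<subseteq> \<sigma>" "\<forall>\<rho>\<in>?R. \<not> \<tau> \<subseteq> \<rho>" for \<tau>
        using that fin by (intro card_mono) (auto intro: finite_subset)
      moreover have "?O \<subseteq> \<sigma> \<and> (\<forall>\<rho>\<in>?R. \<not> ?O \<subseteq> \<rho>)" using opp_subset[of P \<sigma>] by blast
      ultimately show ?thesis unfolding is_arg_min_def by (meson not_less)
    qed
    moreover have "card ?O < card \<sigma>"
      using G P opp_subset[of P \<sigma>] fin by (intro psubset_card_mono) auto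
    ultimately have "critical_tile \<sigma> (card ?O) (deprived \<sigma> P)"
      using fin R unfolding critical_tile_def by (intro conjI exI[of _ ?R]) auto
    then show ?thesis by (auto simp: h_tile_def)
  next
    case False
    then have "deprived \<sigma> P = deprived \<sigma> ({} \<union> ?R)"
      using fin P by (intro deprived_opp) auto
    then have "basic_tile \<sigma> (card ?O) (deprived \<sigma> P)"
      using fin R unfolding basic_tile_def by (intro conjI exI[of _ ?R]) auto
    then show ?thesis by (auto simp: h_tile_def)
  qed
qed

text \<open>If \<mu> contains \<open>opp P \<sigma>\<close>, it serves as the additional removed
  face. If it does not, no facet containing \<open>opp P \<sigma>\<close> meets \<sigma>, and
  removing the ridges is enough.\<close>

lemma one_face_morse_tile:
  assumes fin: "finite \<sigma>" "\<sigma> \<noteq> {}" and P: "\<And>F. F \<in> P \<Longrightarrow> finite F \<and> \<not> \<sigma> \<subseteq> F"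
    and \<mu>: "\<mu> \<subseteq> \<sigma>" "\<mu> = {} \<or> (\<exists>G\<in>P. \<mu> \<subseteq> G)"
    and face: "\<And>F. F \<in> P \<Longrightarrow> opp P \<sigma> \<subseteq> F \<Longrightarrow> \<sigma> \<inter> F \<subseteq> \<mu>"
  shows "\<exists>k. morse_tile \<sigma> k (deprived \<sigma> P)"
proof -
  let ?O = "opp P \<sigma>"
  let ?R = "(\<lambda>w. \<sigma> - {w}) ` ?O"
  note R = opp_ridges[OF fin opp_subset]
  show ?thesis
  proof (cases "?O \<subseteq> \<mu> \<and> \<mu> \<noteq> {}")
    case True
    then obtain G where G: "G \<in> P" "\<mu> \<subseteq> G" using \<mu> by blast
    have "deprived \<sigma> P = deprived \<sigma> ({\<mu>} \<union> ?R)"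
      using fin P \<mu> G face by (intro deprived_opp) auto
    \<comment> \<open>Codimension one is excluded: the vertex opposite to a covered ridge belongs to
      \<open>?O\<close>, which is contained in \<mu>.\<close>
    moreover have "card \<mu> + 2 \<le> card \<sigma>"
    proof -
      have "\<mu> \<noteq> \<sigma>" using G P by blast
      then obtain x where x: "x \<in> \<sigma>" "x \<notin> \<mu>" using \<mu>(1) by blast
      then have "x \<notin> ?O" using True by blast
      then have "\<mu> \<noteq> \<sigma> - {x}" using x G unfolding opp_def by blast
      then have "\<mu> \<subset> \<sigma> - {x}" using x \<mu>(1) by blast
      then have "card \<mu> < card (\<sigma> - {x})" using fin by (intro psubset_card_mono) auto
      then show ?thesis using card_Suc_Diff1[OF fin(1) x(1)] by simp
    qed
    moreover have "\<forall>\<rho>\<in>?R. \<not> \<mu> \<subseteq> \<rho>" using True by blast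
    ultimately have "morse_tile \<sigma> (card ?O) (deprived \<sigma> P)"
      using fin R \<mu>(1) unfolding morse_tile_def
      by (intro conjI exI[of _ ?R] disjI2 exI[of _ \<mu>]) auto
    then show ?thesis by blast
  next
    case False
    have "deprived \<sigma> P = deprived \<sigma> ({} \<union> ?R)"
    proof (rule deprived_opp)
      fix F assume F: "F \<in> P" "?O \<subseteq> F" "\<sigma> \<inter> F \<noteq> {}"
      then have "\<sigma> \<inter> F \<subseteq> \<mu>" using face by blast
      then show "\<exists>\<mu>\<in>{}. \<sigma> \<inter> F \<subseteq> \<mu>" using False F opp_subset[of P \<sigma>] by blast
    qed (use fin P in auto)
    then have "morse_tile \<sigma> (card ?O) (deprived \<sigma> P)"
      using fin R unfolding morse_tile_def by (intro conjI exI[of _ ?R]) auto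
    then show ?thesis by blast
  qed
qed

section \<open>Stellar subdivision of an ordered list of facets\<close>

text \<open>The accumulator \<open>P\<close> holds the facets already placed. As they count only as
  a set, properties of an order can be proved by induction from the front, with whole blocks
  exchanged.\<close>

fun along :: "('a set \<Rightarrow> 'a \<Rightarrow> bool) \<Rightarrow> 'a set \<Rightarrow> 'a list \<Rightarrow> bool" where
  "along Q P [] \<longleftrightarrow> True"
| "along Q P (x # xs) \<longleftrightarrow> Q P x \<and> along Q (insert x P) xs"

lemma along_append: "along Q P (xs @ ys) \<longleftrightarrow> along Q P xs \<and> along Q (P \<union> set xs) ys"
  by (induction xs arbitrary: P) (auto simp: insert_commute)

lemma along_iff_split:
  "along Q P xs \<longleftrightarrow> (\<forall>pre x post. xs = pre @ x # post \<longrightarrow> Q (P \<union> set pre) x)"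
proof
  assume "along Q P xs"
  then show "\<forall>pre x post. xs = pre @ x # post \<longrightarrow> Q (P \<union> set pre) x"
    by (auto simp: along_append)
next
  assume "\<forall>pre x post. xs = pre @ x # post \<longrightarrow> Q (P \<union> set pre) x"
  then show "along Q P xs"
  proof (induction xs arbitrary: P)
    case (Cons y xs)
    have "Q P y" using Cons.prems[rule_format, of "[]"] by simp
    moreover have "along Q (insert y P) xs"
      using Cons.prems[rule_format, of "y # pre" for pre] by (intro Cons.IH) auto
    ultimately show ?case by simp
  qed simp
qed

lemma along_iff_nth:
  "along Q {} xs \<longleftrightarrow> (\<forall>p<length xs. Q (set (take p xs)) (xs ! p))"
proof
  assume along: "along Q {} xs"
  show "\<forall>p<length xs. Q (set (take p xs)) (xs ! p)"
  proof (intro allI impI)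
    fix p assume "p < length xs"
    then have "xs = take p xs @ xs ! p # drop (Suc p) xs" by (rule id_take_nth_drop)
    with along show "Q (set (take p xs)) (xs ! p)" unfolding along_iff_split by (metis Un_empty_left)
  qed
next
  assume nth: "\<forall>p<length xs. Q (set (take p xs)) (xs ! p)"
  show "along Q {} xs" unfolding along_iff_split
  proof (intro allI impI)
    fix pre x post assume "xs = pre @ x # post"
    then show "Q ({} \<union> set pre) x" using nth[rule_format, of "length pre"] by simp
  qed
qed

text \<open>The base exceeds \<open>n + 1\<close>, the largest number of facets that can replace one
  facet, so replacements with a smaller \<open>ext\<close> weigh less in total. The value 0 at
  \<open>m = 0\<close> makes cost zero mean that every \<open>ext\<close> is empty, and lets facets
  with empty \<open>ext\<close> be subdivided at no cost.\<close>

definition weight :: "nat \<Rightarrow> nat \<Rightarrow> nat" where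
  "weight n m = (if m = 0 then 0 else (n + 2) ^ m)"

lemma weight_mono: "m \<le> m' \<Longrightarrow> weight n m \<le> weight n m'"
  by (auto simp: weight_def intro: power_increasing)

lemma weight_step:
  assumes "c \<le> n + 1"
  shows "c * weight n (m - 1) \<le> weight n m" and "0 < m \<Longrightarrow> c * weight n (m - 1) < weight n m"
proof -
  have less: "c * weight n (m - 1) < weight n m" if "0 < m"
  proof -
    obtain k where m: "m = Suc k" using gr0_implies_Suc[OF \<open>0 < m\<close>] by blast
    have "c * weight n k \<le> (n + 1) * (n + 2) ^ k"
      using assms by (intro mult_mono) (auto simp: weight_def)
    also have "\<dots> < (n + 2) ^ m" by (simp add: m)
    finally show ?thesis by (simp add: m weight_def)
  qed
  then show "0 < m \<Longrightarrow> c * weight n (m - 1) < weight n m" .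
  show "c * weight n (m - 1) \<le> weight n m"
    using less by (cases m) (auto simp: weight_def)
qed

fun cost :: "nat \<Rightarrow> 'a set set \<Rightarrow> 'a set list \<Rightarrow> nat" where
  "cost n P [] = 0"
| "cost n P (\<sigma> # Fs) = weight n (card (ext P \<sigma>)) + cost n (insert \<sigma> P) Fs"

lemma cost_append: "cost n P (Fs @ Gs) = cost n P Fs + cost n (P \<union> set Fs) Gs"
  by (induction Fs arbitrary: P) (auto simp: insert_commute)

lemma cost_bound:
  "along (\<lambda>P \<sigma>. card (ext P \<sigma>) \<le> m) P Fs \<Longrightarrow> cost n P Fs \<le> length Fs * weight n m"
proof (induction Fs arbitrary: P)
  case (Cons \<sigma> Fs)
  then show ?case using add_mono[OF weight_mono[of "card (ext P \<sigma>)" m n] Cons.IH[of "insert \<sigma> P"]] by simp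
qed simp

lemma cost_0:
  assumes "cost n P Fs = 0" "\<And>F. F \<in> set Fs \<Longrightarrow> finite F"
  shows "along (\<lambda>P \<sigma>. ext P \<sigma> = {}) P Fs"
  using assms
  by (induction Fs arbitrary: P) (auto simp: weight_def finite_ext split: if_splits)

section \<open>The facets of a stellar subdivision\<close>

definition star :: "'a set \<Rightarrow> 'a \<Rightarrow> 'a set set \<Rightarrow> 'a set set" where
  "star \<tau> v \<F> = {F \<in> \<F>. \<not> \<tau> \<subseteq> F} \<union> {insert v (F - {w}) | F w. F \<in> \<F> \<and> \<tau> \<subseteq> F \<and> w \<in> \<tau>}"

lemma star_keep: "F \<in> \<F> \<Longrightarrow> \<not> \<tau> \<subseteq> F \<Longrightarrow> F \<in> star \<tau> v \<F>"
  by (simp add: star_def)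

lemma star_cone: "F \<in> \<F> \<Longrightarrow> \<tau> \<subseteq> F \<Longrightarrow> w \<in> \<tau> \<Longrightarrow> insert v (F - {w}) \<in> star \<tau> v \<F>"
  unfolding star_def by blast

lemma star_cases [consumes 1, case_names keep cone]:
  assumes "G \<in> star \<tau> v \<F>"
  obtains "G \<in> \<F>" "\<not> \<tau> \<subseteq> G"
  | F w where "F \<in> \<F>" "\<tau> \<subseteq> F" "w \<in> \<tau>" "G = insert v (F - {w})"
  using assms unfolding star_def by blast

lemma star_insert:
  "star \<tau> v (insert \<sigma> \<F>) =
    (if \<tau> \<subseteq> \<sigma> then (\<lambda>w. insert v (\<sigma> - {w})) ` \<tau> else {\<sigma>}) \<union> star \<tau> v \<F>"
  by (auto simp: star_def)

lemma star_empty [simp]: "star \<tau> v {} = {}"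
  by (auto simp: star_def)

lemma star_eq_empty:
  assumes "\<tau> \<noteq> {}"
  shows "star \<tau> v \<F> = {} \<longleftrightarrow> \<F> = {}"
proof
  assume *: "star \<tau> v \<F> = {}"
  obtain w where "w \<in> \<tau>" using assms by blast
  then have "F \<notin> \<F>" for F
    using * star_keep[of F \<F> \<tau> v] star_cone[of F \<F> \<tau> w v] by blast
  then show "\<F> = {}" by blast
qed simp

lemma stellar_keep: "\<sigma> \<in> K \<Longrightarrow> \<not> \<tau> \<subseteq> \<sigma> \<Longrightarrow> \<sigma> \<in> stellar K \<tau> v"
  by (simp add: stellar_def)

lemma stellar_cone:
  "\<sigma> \<in> K \<Longrightarrow> \<tau> \<subseteq> \<sigma> \<Longrightarrow> \<rho> \<subseteq> \<sigma> \<Longrightarrow> \<not> \<tau> \<subseteq> \<rho> \<Longrightarrow> insert v \<rho> \<in> stellar K \<tau> v"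
  unfolding stellar_def by blast

lemma stellar_cases [consumes 1, case_names keep cone]:
  assumes "s \<in> stellar K \<tau> v"
  obtains "s \<in> K" "\<not> \<tau> \<subseteq> s"
  | \<rho> \<sigma> where "s = insert v \<rho>" "\<sigma> \<in> K" "\<tau> \<subseteq> \<sigma>" "\<rho> \<subseteq> \<sigma>" "\<not> \<tau> \<subseteq> \<rho>"
  using assms unfolding stellar_def by blast

text \<open>The maximal faces of a facet not containing \<tau> are the ridges opposite to the
  vertices of \<tau>: a face that does not contain \<tau> lacks some \<open>w\<close> in \<tau>, and
  then lies in the cone over the ridge opposite to \<open>w\<close>.\<close>

lemma stellar_generated:
  assumes "v \<notin> \<Union>\<F>" "\<tau> \<noteq> {}"
  shows "stellar (generated \<F>) \<tau> v = generated (star \<tau> v \<F>)"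
proof (intro equalityI subsetI)
  fix s assume "s \<in> stellar (generated \<F>) \<tau> v"
  then show "s \<in> generated (star \<tau> v \<F>)"
  proof (cases rule: stellar_cases)
    case keep
    then obtain F where F: "F \<in> \<F>" "s \<subseteq> F" "s \<noteq> {}" by (elim generatedE)
    obtain w where w: "w \<in> \<tau>" "w \<notin> s" using keep by blast
    show ?thesis
    proof (cases "\<tau> \<subseteq> F")
      case True
      show ?thesis using F w by (intro generatedI[OF star_cone[OF F(1) True w(1)]]) auto
    next
      case False
      then show ?thesis using F star_keep generatedI by metis
    qed
  next
    case (cone \<rho> \<sigma>)
    then obtain F where F: "F \<in> \<F>" "\<sigma> \<subseteq> F" by (elim generatedE)
    then have "\<tau> \<subseteq> F" using cone by blast
    obtain w where w: "w \<in> \<tau>" "w \<notin> \<rho>" using cone by blast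
    show ?thesis using F w cone by (intro generatedI[OF star_cone[OF F(1) \<open>\<tau> \<subseteq> F\<close> w(1)]]) auto
  qed
next
  fix s assume "s \<in> generated (star \<tau> v \<F>)"
  then obtain G where G: "G \<in> star \<tau> v \<F>" "s \<subseteq> G" "s \<noteq> {}" by (elim generatedE)
  from G(1) show "s \<in> stellar (generated \<F>) \<tau> v"
  proof (cases rule: star_cases)
    case keep
    then show ?thesis using G by (intro stellar_keep generatedI[of G]) auto
  next
    case (cone F w)
    have "w \<noteq> v" using cone assms by blast
    have F: "F \<in> generated \<F>" using cone assms by (intro generatedI[of F]) auto
    show ?thesis
    proof (cases "v \<in> s")
      case True
      then have "s = insert v (s - {v})" by blast
      moreover have "insert v (s - {v}) \<in> stellar (generated \<F>) \<tau> v"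
        using cone G \<open>w \<noteq> v\<close> by (intro stellar_cone[OF F]) auto
      ultimately show ?thesis by simp
    next
      case False
      then show ?thesis using cone G \<open>w \<noteq> v\<close> by (intro stellar_keep generatedI[of F]) auto
    qed
  qed
qed

section \<open>How a subdivision changes the tile of one facet\<close>

lemma card_le_eqI:
  "finite A \<Longrightarrow> B \<subseteq> A \<Longrightarrow> card A \<le> card B \<Longrightarrow> B = A"
  by (simp add: card_seteq)

lemma codim1_eq:
  assumes "finite \<sigma>" "card \<sigma> = n + 1" "\<tau> \<subseteq> \<sigma>" "n \<le> card \<tau>" "x \<in> \<sigma>" "x \<notin> \<tau>"
  shows "\<tau> = \<sigma> - {x}"
proof -
  have "\<tau> \<subseteq> \<sigma> - {x}" using assms by blast
  moreover have "card (\<sigma> - {x}) = n" using assms by simp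
  ultimately show ?thesis using assms by (intro card_le_eqI) auto
qed

text \<open>The bound on \<open>card \<tau>\<close> treats facets and ridges together. A facet
  containing \<tau> is \<tau> itself or has exactly one further vertex.\<close>

locale subdivision =
  fixes n :: nat and \<tau> :: "'a set" and v :: 'a
  assumes \<tau>_nonempty: "\<tau> \<noteq> {}" and \<tau>_finite: "finite \<tau>" and \<tau>_card: "n \<le> card \<tau>"
begin

definition old :: "'a set \<Rightarrow> bool" where
  "old F \<longleftrightarrow> finite F \<and> card F = n + 1 \<and> v \<notin> F"

lemma old_antisym: "old F \<Longrightarrow> old G \<Longrightarrow> F \<subseteq> G \<Longrightarrow> F = G"
  by (intro card_le_eqI) (auto simp: old_def)

context
  fixes P :: "'a set set" and \<sigma> :: "'a set"
  assumes P: "\<And>F. F \<in> P \<Longrightarrow> old F" and \<sigma>: "old \<sigma>" "\<sigma> \<notin> P"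
begin

text \<open>Both sets depend only on which faces of \<sigma> are covered. Such a face lacks some
  vertex \<open>w\<close> of \<tau>; if it was covered by a facet containing \<tau>, it is still
  covered by the cone of that facet omitting \<open>w\<close>. Facets not containing \<tau>
  therefore keep their cost.\<close>

lemma opp_ext_star:
  assumes "\<not> \<tau> \<subseteq> \<sigma>"
  shows "opp (star \<tau> v P) \<sigma> = opp P \<sigma>" "ext (star \<tau> v P) \<sigma> = ext P \<sigma>"
proof -
  have iff: "(\<exists>F\<in>star \<tau> v P. s \<subseteq> F) \<longleftrightarrow> (\<exists>F\<in>P. s \<subseteq> F)" if s: "s \<subseteq> \<sigma>" for s
  proof
    assume "\<exists>F\<in>star \<tau> v P. s \<subseteq> F"
    moreover have "v \<notin> s" using \<sigma> s by (auto simp: old_def)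
    ultimately show "\<exists>F\<in>P. s \<subseteq> F" by (auto elim!: star_cases)
  next
    assume "\<exists>F\<in>P. s \<subseteq> F"
    then obtain F where F: "F \<in> P" "s \<subseteq> F" by blast
    obtain w where "w \<in> \<tau>" "w \<notin> s" using assms s by blast
    then have "s \<subseteq> insert v (F - {w})" using F by blast
    then show "\<exists>F\<in>star \<tau> v P. s \<subseteq> F"
      using F \<open>w \<in> \<tau>\<close> star_keep[of F P \<tau> v] star_cone[of F P \<tau> w v] by blast
  qed
  have 1: "(\<exists>F\<in>star \<tau> v P. \<sigma> - {w} \<subseteq> F) \<longleftrightarrow> (\<exists>F\<in>P. \<sigma> - {w} \<subseteq> F)" for w
    by (rule iff) blast
  show opp: "opp (star \<tau> v P) \<sigma> = opp P \<sigma>" unfolding opp_def 1 ..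
  have 2: "(\<exists>F\<in>star \<tau> v P. insert w (opp P \<sigma>) \<subseteq> F) \<longleftrightarrow> (\<exists>F\<in>P. insert w (opp P \<sigma>) \<subseteq> F)"
    if "w \<in> \<sigma>" for w
    using that opp_subset[of P \<sigma>] by (intro iff) blast
  show "ext (star \<tau> v P) \<sigma> = ext P \<sigma>" unfolding ext_def opp using 2 by blast
qed

context
  fixes pre :: "'a set" and w :: 'a
  assumes \<tau>\<sigma>: "\<tau> \<subseteq> \<sigma>" and pre: "pre \<subseteq> \<tau>" and w: "w \<in> \<tau>" "w \<notin> pre"
begin

text \<open>The moment when a cone facet of \<sigma> is placed: \<open>w\<close> is the vertex of
  \<tau> that it omits, and \<open>pre\<close> are the vertices omitted by the cones of \<sigma>
  placed before it.\<close>

abbreviation "P' \<equiv> star \<tau> v P \<union> (\<lambda>u. insert v (\<sigma> - {u})) ` pre"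
abbreviation "\<sigma>' \<equiv> insert v (\<sigma> - {w})"

text \<open>Three kinds of earlier neighbours. A neighbour of \<sigma> opposite to a vertex outside
  \<tau> contains \<tau>, and its cone omitting \<open>w\<close> is adjacent to
  \<open>\<sigma>'\<close>; a cone of \<sigma> omitting \<open>u\<close> is adjacent opposite to
  \<open>u\<close>; and if the base \<open>\<sigma> - {w}\<close> was covered, then by a facet not
  containing \<tau>, which survives the subdivision.\<close>

lemma opp_cone:
  "opp P \<sigma> - \<tau> \<subseteq> opp P' \<sigma>'" "pre \<subseteq> opp P' \<sigma>'" "w \<in> opp P \<sigma> \<Longrightarrow> v \<in> opp P' \<sigma>'"
proof -
  have v: "v \<notin> \<sigma>" using \<sigma> by (simp add: old_def)
  show "opp P \<sigma> - \<tau> \<subseteq> opp P' \<sigma>'"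
  proof
    fix r assume r: "r \<in> opp P \<sigma> - \<tau>"
    then obtain F where F: "r \<in> \<sigma>" "F \<in> P" "\<sigma> - {r} \<subseteq> F" by (auto simp: opp_def)
    have "\<tau> \<subseteq> F" using F \<tau>\<sigma> r by blast
    then have "insert v (F - {w}) \<in> P'" using star_cone[OF F(2) \<open>\<tau> \<subseteq> F\<close> w(1)] by blast
    moreover have "\<sigma>' - {r} \<subseteq> insert v (F - {w})" using F by blast
    moreover have "r \<in> \<sigma>'" using r w F by blast
    ultimately show "r \<in> opp P' \<sigma>'" by (intro oppI)
  qed
  show "pre \<subseteq> opp P' \<sigma>'"
  proof
    fix u assume u: "u \<in> pre"
    then have "\<sigma>' - {u} \<subseteq> insert v (\<sigma> - {u})" "u \<in> \<sigma>'" using w pre \<tau>\<sigma> by auto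
    then show "u \<in> opp P' \<sigma>'" using u by (intro oppI[of u _ "insert v (\<sigma> - {u})"]) auto
  qed
  assume "w \<in> opp P \<sigma>"
  then obtain F where F: "F \<in> P" "\<sigma> - {w} \<subseteq> F" by (elim oppE)
  have "\<not> \<tau> \<subseteq> F"
  proof
    assume "\<tau> \<subseteq> F"
    then have "\<sigma> \<subseteq> F" using F w by blast
    then show False using old_antisym[OF \<sigma>(1) P[OF F(1)]] F(1) \<sigma>(2) by blast
  qed
  then have "F \<in> P'" using star_keep[OF F(1)] by blast
  moreover have "\<sigma>' - {v} \<subseteq> F" using F by blast
  ultimately show "v \<in> opp P' \<sigma>'" by (intro oppI) auto
qed

text \<open>No new facet contains the least face of the new tile. A cone of \<sigma> lacks its
  omitted vertex, which lies in \<open>pre\<close>. A cone of another facet \<open>F\<close>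
  containing \<tau> forces \<tau> to be the ridge \<open>\<sigma> - {x}\<close>, so \<open>x\<close>
  belongs to \<open>opp P \<sigma>\<close> and hence to the least face, but not to that cone. This
  is where the bound on the codimension of \<tau> is used.\<close>

lemma cofacet_cone:
  assumes "G \<in> P'" "opp P' \<sigma>' \<subseteq> G"
  shows "G \<in> P"
proof (rule ccontr)
  assume "G \<notin> P"
  then consider u where "u \<in> pre" "G = insert v (\<sigma> - {u})"
    | F u where "F \<in> P" "\<tau> \<subseteq> F" "u \<in> \<tau>" "G = insert v (F - {u})"
    using assms(1) by (auto elim!: star_cases)
  then show False
  proof cases
    case 1
    then have "u \<in> \<sigma>" using pre \<tau>\<sigma> by blast
    then have "u \<notin> G" using 1 \<sigma> by (auto simp: old_def)
    then show False using opp_cone(2) 1(1) assms(2) by blast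
  next
    case 2
    have "\<not> \<sigma> \<subseteq> F" using old_antisym[OF \<sigma>(1) P[OF 2(1)]] 2(1) \<sigma>(2) by blast
    then obtain x where x: "x \<in> \<sigma>" "x \<notin> F" by blast
    then have "\<tau> = \<sigma> - {x}"
      using codim1_eq[of \<sigma> n \<tau> x] \<sigma> \<tau>\<sigma> \<tau>_card 2 by (auto simp: old_def)
    then have "x \<in> opp P \<sigma> - \<tau>" using x 2 oppI[OF x(1) 2(1)] by blast
    then have "x \<in> G" using opp_cone(1) assms(2) by blast
    then show False using x 2 \<sigma> by (auto simp: old_def)
  qed
qed

text \<open>A facet witnessing a vertex of the new \<open>ext\<close> is old and so omits
  \<open>v\<close>; hence \<open>v\<close> is not in the new \<open>opp\<close>, and
  \<open>w\<close> is not in \<open>opp P \<sigma>\<close>. By the assumption on the order the new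
  \<open>opp\<close> then contains the old one, so the same facet witnesses the vertex for \<sigma>.
  The vertex \<open>w\<close> is gone, and \<open>pre\<close> has moved into the new
  \<open>opp\<close>.\<close>

lemma ext_cone:
  assumes "w \<notin> opp P \<sigma> \<Longrightarrow> \<tau> \<inter> opp P \<sigma> \<subseteq> pre"
  shows "ext P' \<sigma>' \<subseteq> (if w \<in> opp P \<sigma> then {} else ext P \<sigma> - insert w pre)"
proof
  fix y assume y: "y \<in> ext P' \<sigma>'"
  then obtain G where y': "y \<in> \<sigma>'" "y \<notin> opp P' \<sigma>'" and G: "G \<in> P'" "insert y (opp P' \<sigma>') \<subseteq> G"
    by (elim extE)
  have GP: "G \<in> P" using cofacet_cone[OF G(1)] G(2) by blast
  then have "v \<notin> G" using P[OF GP] by (simp add: old_def)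
  then have "y \<noteq> v" "v \<notin> opp P' \<sigma>'" using G by auto
  then have "w \<notin> opp P \<sigma>" using opp_cone(3) by blast
  moreover from this have "opp P \<sigma> \<subseteq> opp P' \<sigma>'" using assms opp_cone(1,2) by blast
  then have "y \<in> ext P \<sigma>" using y' G(2) \<open>y \<noteq> v\<close> by (intro extI[OF _ _ GP]) blast+
  moreover have "y \<notin> insert w pre" using y' \<open>y \<noteq> v\<close> opp_cone(2) by blast
  ultimately show "y \<in> (if w \<in> opp P \<sigma> then {} else ext P \<sigma> - insert w pre)" by simp
qed

end

text \<open>The order of the cones: omit the vertices of \<tau> in \<open>opp P \<sigma>\<close>
  before all others, then a vertex \<open>e\<close> of \<open>ext P \<sigma>\<close> if there is
  one, then the rest. Cones over covered ridges have empty \<open>ext\<close>, and all others lose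
  at least \<open>e\<close>. The truncated subtraction is deliberate: an empty \<open>ext\<close>
  stays empty.\<close>

lemma cone_block:
  assumes \<tau>\<sigma>: "\<tau> \<subseteq> \<sigma>" and adm: "ext P \<sigma> = {} \<or> ext P \<sigma> \<inter> \<tau> \<noteq> {}"
    and conn: "P = {} \<or> opp P \<sigma> \<noteq> {}"
  obtains ws where "distinct ws" "set ws = \<tau>"
    "along (\<lambda>P \<sigma>. P = {} \<or> opp P \<sigma> \<noteq> {}) (star \<tau> v P) (map (\<lambda>w. insert v (\<sigma> - {w})) ws)"
    "along (\<lambda>P' \<sigma>'. card (ext P' \<sigma>') \<le> card (ext P \<sigma>) - 1) (star \<tau> v P)
      (map (\<lambda>w. insert v (\<sigma> - {w})) ws)"
proof -
  let ?f = "\<lambda>w. insert v (\<sigma> - {w})"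
  obtain As where As: "distinct As" "set As = \<tau> \<inter> opp P \<sigma>"
    using finite_distinct_list \<tau>_finite by (metis finite_Int)
  obtain Bs where Bs: "distinct Bs" "set Bs = \<tau> - opp P \<sigma>"
    and hd: "ext P \<sigma> \<noteq> {} \<Longrightarrow> \<exists>e Cs. Bs = e # Cs \<and> e \<in> ext P \<sigma>"
  proof (cases "ext P \<sigma> = {}")
    case True
    obtain Bs where "distinct Bs" "set Bs = \<tau> - opp P \<sigma>"
      using finite_distinct_list \<tau>_finite by (metis finite_Diff)
    then show thesis using True that by blast
  next
    case False
    then obtain e where e: "e \<in> ext P \<sigma>" "e \<in> \<tau>" using adm by blast
    then have "e \<notin> opp P \<sigma>" by (simp add: ext_def)
    obtain Cs where "distinct Cs" "set Cs = \<tau> - opp P \<sigma> - {e}"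
      using finite_distinct_list \<tau>_finite by (metis finite_Diff)
    then show thesis using e \<open>e \<notin> opp P \<sigma>\<close> that[of "e # Cs"] by auto
  qed
  let ?ws = "As @ Bs"
  have set_ws: "set ?ws = \<tau>" using As Bs by auto
  have dist_ws: "distinct ?ws" using As Bs by auto
  have key: "(star \<tau> v P \<union> ?f ` set pre = {} \<or> opp (star \<tau> v P \<union> ?f ` set pre) (?f w) \<noteq> {}) \<and>
      card (ext (star \<tau> v P \<union> ?f ` set pre) (?f w)) \<le> card (ext P \<sigma>) - 1"
    if split: "?ws = pre @ w # post" for pre w post
  proof -
    have "set pre \<subseteq> \<tau>" "w \<in> \<tau>" "w \<notin> set pre"
      using set_ws dist_ws unfolding split by auto
    note cone = \<tau>\<sigma> this
    \<comment> \<open>Once \<open>w\<close> is outside \<open>opp P \<sigma>\<close>, all of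
      \<open>As\<close> has been placed, and \<open>e\<close>, the head of \<open>Bs\<close>, is
      either \<open>w\<close> itself or already in \<open>pre\<close>.\<close>
    have first: "\<tau> \<inter> opp P \<sigma> \<subseteq> set pre \<and> (ext P \<sigma> \<noteq> {} \<longrightarrow> ext P \<sigma> \<inter> insert w (set pre) \<noteq> {})"
      if w: "w \<notin> opp P \<sigma>"
    proof -
      from split consider us where "As = pre @ us" "us @ Bs = w # post"
        | us where "pre = As @ us" "Bs = us @ w # post"
        by (auto simp: append_eq_append_conv2)
      then obtain us where us: "pre = As @ us" "Bs = us @ w # post"
      proof cases
        case 1
        then have "us = []" using w As by (cases us) auto
        then show thesis using 1 that[of "[]"] by simp
      qed
      then show ?thesis using hd As by (cases us) auto
    qed
    have "opp (star \<tau> v P \<union> ?f ` set pre) (?f w) \<noteq> {}" if "star \<tau> v P \<union> ?f ` set pre \<noteq> {}"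
    proof (cases "set pre = {}")
      case True
      then have "opp P \<sigma> \<noteq> {}" using that conn by auto
      show ?thesis
      proof (cases "w \<in> opp P \<sigma>")
        case False
        then have "\<tau> \<inter> opp P \<sigma> = {}" using first True by simp
        then have "opp P \<sigma> - \<tau> \<noteq> {}" using \<open>opp P \<sigma> \<noteq> {}\<close> by auto
        then show ?thesis using opp_cone(1)[OF cone] by auto
      qed (use opp_cone(3)[OF cone] in auto)
    next
      case False
      then show ?thesis using opp_cone(2)[OF cone] by auto
    qed
    moreover have "card (ext (star \<tau> v P \<union> ?f ` set pre) (?f w)) \<le> card (ext P \<sigma>) - 1"
    proof -
      have sub: "ext (star \<tau> v P \<union> ?f ` set pre) (?f w) \<subseteq>
          (if w \<in> opp P \<sigma> then {} else ext P \<sigma> - insert w (set pre))"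
        using first by (intro ext_cone[OF cone]) simp
      have fin: "finite (ext P \<sigma>)" using \<sigma> by (simp add: finite_ext old_def)
      show ?thesis
      proof (cases "w \<in> opp P \<sigma> \<or> ext P \<sigma> = {}")
        case True
        then have "ext (star \<tau> v P \<union> ?f ` set pre) (?f w) = {}" using sub by (auto split: if_splits)
        then show ?thesis by simp
      next
        case False
        then have "ext (star \<tau> v P \<union> ?f ` set pre) (?f w) \<subset> ext P \<sigma>" using sub first by auto
        from psubset_card_mono[OF fin this] show ?thesis by simp
      qed
    qed
    ultimately show ?thesis by blast
  qed
  have along: "along Q (star \<tau> v P) (map ?f ?ws)"
    if Q: "\<And>pre w post. ?ws = pre @ w # post \<Longrightarrow> Q (star \<tau> v P \<union> ?f ` set pre) (?f w)" for Q
    unfolding along_iff_split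
  proof (intro allI impI)
    fix pre x post assume "map ?f ?ws = pre @ x # post"
    then obtain pre' w post' where "?ws = pre' @ w # post'" "pre = map ?f pre'" "x = ?f w"
      unfolding map_eq_append_conv map_eq_Cons_conv by blast
    then show "Q (star \<tau> v P \<union> set pre) x" using Q by simp
  qed
  show thesis
  proof (rule that[OF dist_ws set_ws])
    show "along (\<lambda>P \<sigma>. P = {} \<or> opp P \<sigma> \<noteq> {}) (star \<tau> v P) (map ?f ?ws)"
      by (rule along) (rule key[THEN conjunct1])
    show "along (\<lambda>P' \<sigma>'. card (ext P' \<sigma>') \<le> card (ext P \<sigma>) - 1) (star \<tau> v P) (map ?f ?ws)"
      by (rule along) (rule key[THEN conjunct2])
  qed
qed

end

text \<open>Each facet containing \<tau> is replaced in place by its block of cones, and the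
  predecessors \<open>P\<close> turn into \<open>star \<tau> v P\<close>. The weak and the strict
  bound are carried together, since the facet responsible for the decrease may stand anywhere in the
  list.\<close>

lemma subdivide_list:
  assumes "\<And>F. F \<in> P \<union> set Fs \<Longrightarrow> old F" "distinct Fs" "set Fs \<inter> P = {}"
    and "along (\<lambda>P \<sigma>. P = {} \<or> opp P \<sigma> \<noteq> {}) P Fs"
    and "along (\<lambda>P \<sigma>. \<tau> \<subseteq> \<sigma> \<longrightarrow> ext P \<sigma> = {} \<or> ext P \<sigma> \<inter> \<tau> \<noteq> {}) P Fs"
  shows "\<exists>Gs. distinct Gs \<and> set Gs = star \<tau> v (set Fs) \<and>
    along (\<lambda>P \<sigma>. P = {} \<or> opp P \<sigma> \<noteq> {}) (star \<tau> v P) Gs \<and>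
    cost n (star \<tau> v P) Gs \<le> cost n P Fs \<and>
    (\<not> along (\<lambda>P \<sigma>. \<tau> \<subseteq> \<sigma> \<longrightarrow> ext P \<sigma> = {}) P Fs \<longrightarrow> cost n (star \<tau> v P) Gs < cost n P Fs)"
  using assms
proof (induction Fs arbitrary: P)
  case Nil
  then show ?case by simp
next
  case (Cons \<sigma> Fs)
  have "\<exists>Gs. distinct Gs \<and> set Gs = star \<tau> v (set Fs) \<and>
    along (\<lambda>P \<sigma>. P = {} \<or> opp P \<sigma> \<noteq> {}) (star \<tau> v (insert \<sigma> P)) Gs \<and>
    cost n (star \<tau> v (insert \<sigma> P)) Gs \<le> cost n (insert \<sigma> P) Fs \<and>
    (\<not> along (\<lambda>P \<sigma>. \<tau> \<subseteq> \<sigma> \<longrightarrow> ext P \<sigma> = {}) (insert \<sigma> P) Fs \<longrightarrow>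
      cost n (star \<tau> v (insert \<sigma> P)) Gs < cost n (insert \<sigma> P) Fs)"
    using Cons.prems by (intro Cons.IH) auto
  then obtain Gs where Gs: "distinct Gs" "set Gs = star \<tau> v (set Fs)"
    "along (\<lambda>P \<sigma>. P = {} \<or> opp P \<sigma> \<noteq> {}) (star \<tau> v (insert \<sigma> P)) Gs"
    "cost n (star \<tau> v (insert \<sigma> P)) Gs \<le> cost n (insert \<sigma> P) Fs"
    "\<not> along (\<lambda>P \<sigma>. \<tau> \<subseteq> \<sigma> \<longrightarrow> ext P \<sigma> = {}) (insert \<sigma> P) Fs \<Longrightarrow>
      cost n (star \<tau> v (insert \<sigma> P)) Gs < cost n (insert \<sigma> P) Fs"
    by blast
  have old: "old \<sigma>" "\<And>F. F \<in> P \<Longrightarrow> old F" "\<And>F. F \<in> set Fs \<Longrightarrow> old F" and \<sigma>: "\<sigma> \<notin> P" "\<sigma> \<notin> set Fs"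
    using Cons.prems by auto
  have conn: "P = {} \<or> opp P \<sigma> \<noteq> {}" using Cons.prems by simp
  show ?case
  proof (cases "\<tau> \<subseteq> \<sigma>")
    case False
    have "\<sigma> \<notin> star \<tau> v (set Fs)" using old(1) \<sigma> by (auto simp: star_def old_def)
    moreover have "opp (star \<tau> v P) \<sigma> = opp P \<sigma>" "ext (star \<tau> v P) \<sigma> = ext P \<sigma>"
      using opp_ext_star[OF old(2,1) \<sigma>(1) False] by auto
    ultimately show ?thesis
      using Gs False conn star_eq_empty[OF \<tau>_nonempty, of v P]
      by (intro exI[of _ "\<sigma> # Gs"]) (auto simp: star_insert)
  next
    case True
    let ?f = "\<lambda>w. insert v (\<sigma> - {w})"
    have adm: "ext P \<sigma> = {} \<or> ext P \<sigma> \<inter> \<tau> \<noteq> {}" using Cons.prems True by simp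
    obtain ws where ws: "distinct ws" "set ws = \<tau>"
      and along: "along (\<lambda>P \<sigma>. P = {} \<or> opp P \<sigma> \<noteq> {}) (star \<tau> v P) (map ?f ws)"
      "along (\<lambda>P' \<sigma>'. card (ext P' \<sigma>') \<le> card (ext P \<sigma>) - 1) (star \<tau> v P) (map ?f ws)"
      using cone_block[OF old(2,1) \<sigma>(1) True adm conn] by blast
    have inj: "inj_on ?f \<tau>"
      using True old(1) by (auto simp: inj_on_def old_def)
    \<comment> \<open>A cone facet determines the facet it comes from:
      \<open>\<sigma> - {w} = F - {u}\<close> with \<open>w\<close> and \<open>u\<close> in both
      \<sigma> and \<open>F\<close> forces \<open>u = w\<close> and then
      \<open>\<sigma> = F\<close>.\<close>
    have disj: "?f ` \<tau> \<inter> star \<tau> v (set Fs) = {}"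
    proof (rule ccontr)
      assume "?f ` \<tau> \<inter> star \<tau> v (set Fs) \<noteq> {}"
      then obtain w where w: "w \<in> \<tau>" "?f w \<in> star \<tau> v (set Fs)" by blast
      have "?f w \<notin> set Fs" using old(3) by (auto simp: old_def)
      then obtain F u where F: "F \<in> set Fs" "\<tau> \<subseteq> F" "u \<in> \<tau>" "?f w = insert v (F - {u})"
        using w(2) by (auto elim!: star_cases)
      then have "\<sigma> - {w} = F - {u}" using old(1) old(3)[of F] by (auto simp: old_def insert_eq_iff)
      moreover from this have "u = w" using F w by blast
      ultimately have "\<sigma> = F" using F w True by blast
      then show False using F \<sigma> by blast
    qed
    have "length ws \<le> n + 1"
      using ws True old(1) distinct_card[of ws] card_mono[of \<sigma> \<tau>] by (simp add: old_def)
    note w = weight_step[OF this, of "card (ext P \<sigma>)"]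
    have c: "cost n (star \<tau> v P) (map ?f ws) \<le> length ws * weight n (card (ext P \<sigma>) - 1)"
      using cost_bound[OF along(2), of n] by simp
    have e: "star \<tau> v P \<union> ?f ` \<tau> = star \<tau> v (insert \<sigma> P)" using True by (auto simp: star_insert)
    have fin: "finite (ext P \<sigma>)" using old(1) by (simp add: finite_ext old_def)
    show ?thesis
    proof (intro exI[of _ "map ?f ws @ Gs"] conjI impI)
      show "distinct (map ?f ws @ Gs)"
        using Gs(1,2) ws inj disj by (auto simp: distinct_map)
      show "set (map ?f ws @ Gs) = star \<tau> v (set (\<sigma> # Fs))"
        using Gs(2) ws True by (simp add: star_insert)
      show "along (\<lambda>P \<sigma>. P = {} \<or> opp P \<sigma> \<noteq> {}) (star \<tau> v P) (map ?f ws @ Gs)"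
        using along(1) Gs(3) by (simp add: along_append ws e)
      show "cost n (star \<tau> v P) (map ?f ws @ Gs) \<le> cost n P (\<sigma> # Fs)"
        using c w(1) Gs(4) by (simp add: cost_append ws e)
      assume "\<not> along (\<lambda>P \<sigma>. \<tau> \<subseteq> \<sigma> \<longrightarrow> ext P \<sigma> = {}) P (\<sigma> # Fs)"
      then consider "0 < card (ext P \<sigma>)" | "\<not> along (\<lambda>P \<sigma>. \<tau> \<subseteq> \<sigma> \<longrightarrow> ext P \<sigma> = {}) (insert \<sigma> P) Fs"
        using fin by (auto simp: card_gt_0_iff)
      then show "cost n (star \<tau> v P) (map ?f ws @ Gs) < cost n P (\<sigma> # Fs)"
        by cases (use c w Gs(4,5) in \<open>simp_all add: cost_append ws e\<close>)
    qed
  qed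
qed

end

text \<open>The invariant carried through the subdivisions. Its last clause says that there is no
  boundary, the form in which the pseudo-manifold condition makes the last tile open.\<close>

definition good_list :: "nat \<Rightarrow> 'a set list \<Rightarrow> bool" where
  "good_list n Fs \<longleftrightarrow> Fs \<noteq> [] \<and> distinct Fs \<and> (\<forall>F\<in>set Fs. finite F \<and> card F = n + 1) \<and>
     along (\<lambda>P \<sigma>. P = {} \<or> opp P \<sigma> \<noteq> {}) {} Fs \<and>
     (\<forall>\<sigma>\<in>set Fs. \<forall>x\<in>\<sigma>. \<exists>F\<in>set Fs. F \<noteq> \<sigma> \<and> \<sigma> - {x} \<subseteq> F)"

text \<open>A neighbour of a cone facet over \<open>F\<close> omitting \<open>w\<close> is, opposite
  to \<open>v\<close>, the old neighbour of \<open>F\<close> across the base, which lacks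
  \<open>w\<close> and so survives; opposite to another vertex of \<tau>, the cone of
  \<open>F\<close> omitting that vertex; opposite to a vertex outside \<tau>, the cone omitting
  \<open>w\<close> of the corresponding neighbour of \<open>F\<close>. For a surviving facet, a
  subdivided neighbour is replaced by one of its cones.\<close>

lemma star_no_boundary:
  assumes v: "v \<notin> \<Union>\<F>" and antichain: "\<And>F G. F \<in> \<F> \<Longrightarrow> G \<in> \<F> \<Longrightarrow> F \<subseteq> G \<Longrightarrow> F = G"
    and ridge: "\<And>F x. F \<in> \<F> \<Longrightarrow> x \<in> F \<Longrightarrow> \<exists>G\<in>\<F>. G \<noteq> F \<and> F - {x} \<subseteq> G"
    and G: "G \<in> star \<tau> v \<F>" "x \<in> G"
  shows "\<exists>H\<in>star \<tau> v \<F>. H \<noteq> G \<and> G - {x} \<subseteq> H"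
  using G(1)
proof (cases rule: star_cases)
  case keep
  then obtain F where F: "F \<in> \<F>" "F \<noteq> G" "G - {x} \<subseteq> F" using ridge G(2) by blast
  show ?thesis
  proof (cases "\<tau> \<subseteq> F")
    case True
    obtain w where w: "w \<in> \<tau>" "w \<notin> G" using keep by blast
    have "insert v (F - {w}) \<noteq> G" using v keep by blast
    moreover have "G - {x} \<subseteq> insert v (F - {w})" using F w by blast
    ultimately show ?thesis using bexI[OF _ star_cone[OF F(1) True w(1)]] by simp
  next
    case False
    then show ?thesis using F bexI[OF _ star_keep[OF F(1) False]] by simp
  qed
next
  case (cone F w)
  have "w \<in> F" "v \<notin> F" "w \<noteq> v" using cone v by auto
  consider "x = v" | "x \<in> \<tau>" "x \<in> F" "x \<noteq> w" | "x \<notin> \<tau>" "x \<in> F" "x \<noteq> w"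
    using G(2) cone by blast
  then show ?thesis
  proof cases
    case 1
    obtain F' where F': "F' \<in> \<F>" "F' \<noteq> F" "F - {w} \<subseteq> F'" using ridge cone \<open>w \<in> F\<close> by blast
    then have "\<not> F \<subseteq> F'" using antichain cone by blast
    then have "w \<notin> F'" using F' by blast
    then have "\<not> \<tau> \<subseteq> F'" using cone by blast
    moreover have "F' \<noteq> G" "G - {x} \<subseteq> F'" using cone 1 F' v by auto
    ultimately show ?thesis using bexI[OF _ star_keep[OF F'(1)]] by simp
  next
    case 2
    have "insert v (F - {x}) \<noteq> G" using cone(4) \<open>w \<in> F\<close> \<open>w \<noteq> v\<close> 2 by auto
    moreover have "G - {x} \<subseteq> insert v (F - {x})" using cone(4) by blast
    ultimately show ?thesis using bexI[OF _ star_cone[OF cone(1,2) 2(1)]] by simp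
  next
    case 3
    obtain F' where F': "F' \<in> \<F>" "F' \<noteq> F" "F - {x} \<subseteq> F'" using ridge cone 3 by blast
    then have "\<not> F \<subseteq> F'" using antichain cone by blast
    then have "x \<notin> F'" using F' by blast
    moreover have "x \<noteq> v" using 3 \<open>v \<notin> F\<close> by blast
    ultimately have "insert v (F' - {w}) \<noteq> G" using G(2) by auto
    moreover have "\<tau> \<subseteq> F'" using 3 cone F' by blast
    moreover have "G - {x} \<subseteq> insert v (F' - {w})" using cone(4) F' by blast
    ultimately show ?thesis using bexI[OF _ star_cone[OF F'(1) _ cone(3)]] by simp
  qed
qed

lemma good_list_antichain:
  assumes "good_list n Fs" "F \<in> set Fs" "G \<in> set Fs" "F \<subseteq> G"
  shows "F = G"
  using assms by (intro card_le_eqI) (auto simp: good_list_def)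

text \<open>\<open>adm\<close> keeps every block of cones from raising the cost, and
  \<open>bad\<close> provides a facet whose block lowers it.\<close>

lemma subdivide_good_list:
  assumes good: "good_list n Fs" and \<tau>: "\<tau> \<noteq> {}" "finite \<tau>" "n \<le> card \<tau>" and v: "v \<notin> \<Union>(set Fs)"
    and adm: "along (\<lambda>P \<sigma>. \<tau> \<subseteq> \<sigma> \<longrightarrow> ext P \<sigma> = {} \<or> ext P \<sigma> \<inter> \<tau> \<noteq> {}) {} Fs"
    and bad: "\<not> along (\<lambda>P \<sigma>. \<tau> \<subseteq> \<sigma> \<longrightarrow> ext P \<sigma> = {}) {} Fs"
  shows "\<exists>Gs. good_list n Gs \<and> generated (set Gs) = stellar (generated (set Fs)) \<tau> v \<and>
    cost n {} Gs < cost n {} Fs"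
proof -
  interpret subdivision n \<tau> v using \<tau> by unfold_locales
  have old: "old F" if "F \<in> set Fs" for F using good v that by (auto simp: good_list_def old_def)
  have "\<exists>Gs. distinct Gs \<and> set Gs = star \<tau> v (set Fs) \<and>
    along (\<lambda>P \<sigma>. P = {} \<or> opp P \<sigma> \<noteq> {}) (star \<tau> v {}) Gs \<and>
    cost n (star \<tau> v {}) Gs \<le> cost n {} Fs \<and>
    (\<not> along (\<lambda>P \<sigma>. \<tau> \<subseteq> \<sigma> \<longrightarrow> ext P \<sigma> = {}) {} Fs \<longrightarrow> cost n (star \<tau> v {}) Gs < cost n {} Fs)"
    using old good adm by (intro subdivide_list) (auto simp: good_list_def)
  then obtain Gs where Gs: "distinct Gs" "set Gs = star \<tau> v (set Fs)"
    "along (\<lambda>P \<sigma>. P = {} \<or> opp P \<sigma> \<noteq> {}) {} Gs" "cost n {} Gs < cost n {} Fs"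
    using bad by auto
  have "good_list n Gs" unfolding good_list_def
  proof (intro conjI ballI)
    have "set Gs \<noteq> {}" using Gs(2) star_eq_empty[OF \<tau>(1)] good by (simp add: good_list_def)
    then show "Gs \<noteq> []" by auto
    fix G assume G: "G \<in> set Gs"
    then have "G \<in> star \<tau> v (set Fs)" using Gs by simp
    then have "finite G \<and> card G = n + 1"
      using old by (cases rule: star_cases) (auto simp: old_def card_insert_if card_Diff_singleton subsetD)
    then show "finite G" "card G = n + 1" by auto
    fix x assume "x \<in> G"
    then show "\<exists>F\<in>set Gs. F \<noteq> G \<and> G - {x} \<subseteq> F"
      using v G good good_list_antichain[OF good] unfolding Gs(2)
      by (intro star_no_boundary) (auto simp: good_list_def)
  qed (use Gs in auto)
  then show ?thesis using Gs stellar_generated[OF v \<tau>(1)] by auto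
qed

section \<open>Choosing a facet or a ridge that lowers the cost\<close>

lemma cost_nonzero_split:
  assumes "cost n {} Fs \<noteq> 0"
  obtains pre \<sigma> post e where "Fs = pre @ \<sigma> # post" "e \<in> ext (set pre) \<sigma>"
proof -
  have *: "along (\<lambda>P \<sigma>. ext P \<sigma> = {}) P Fs \<Longrightarrow> cost n P Fs = 0" for P
    by (induction Fs arbitrary: P) (auto simp: weight_def)
  have "\<not> along (\<lambda>P \<sigma>. ext P \<sigma> = {}) {} Fs" using *[of "{}"] assms by auto
  then show thesis using that unfolding along_iff_split by auto
qed

lemma split_cases:
  assumes "distinct xs" "xs = pre @ x # post" "xs = pre' @ y # post'"
  obtains "x = y" "pre = pre'" | "x \<in> set pre'" | "y \<in> set pre"
  using assms by (auto simp: append_eq_append_conv2 append_eq_Cons_conv Cons_eq_append_conv)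

lemma facets_generated:
  assumes "good_list n Fs"
  shows "facets (generated (set Fs)) = set Fs"
proof (intro equalityI subsetI)
  fix s assume s: "s \<in> facets (generated (set Fs))"
  then obtain F where F: "F \<in> set Fs" "s \<subseteq> F" "s \<noteq> {}" by (auto simp: facets_def generated_def)
  then have "F \<in> generated (set Fs)" by (intro generatedI[of F]) auto
  then show "s \<in> set Fs" using s F by (auto simp: facets_def)
next
  fix F assume F: "F \<in> set Fs"
  then have "F \<noteq> {}" using assms by (auto simp: good_list_def)
  have "G = F" if "G \<in> generated (set Fs)" "F \<subseteq> G" for G
  proof -
    obtain H where H: "H \<in> set Fs" "G \<subseteq> H" using \<open>G \<in> generated (set Fs)\<close> by (elim generatedE)
    then have "F = H" using good_list_antichain[OF assms F] that by blast
    then show ?thesis using H that by blast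
  qed
  then show "F \<in> facets (generated (set Fs))" using F \<open>F \<noteq> {}\<close> generatedI[of F] by (auto simp: facets_def)
qed

lemma fresh_vertex:
  assumes "infinite (UNIV :: 'a set)" "good_list n (Fs :: 'a set list)"
  obtains v where "v \<notin> \<Union>(set Fs)" "v \<notin> \<Union>(generated (set Fs))"
proof -
  have "finite (\<Union>(set Fs))" using assms(2) by (auto simp: good_list_def)
  then obtain v where "v \<notin> \<Union>(set Fs)" using assms(1) ex_new_if_finite by blast
  then show thesis using that by (auto simp: generated_def)
qed

text \<open>Any facet \<sigma> with nonempty \<open>ext\<close> will do: no other facet contains it,
  and its \<open>ext\<close> consists of vertices of \<sigma>.\<close>

lemma facet_step:
  assumes inf: "infinite (UNIV :: 'a set)" and good: "good_list n (Fs :: 'a set list)" and "cost n {} Fs \<noteq> 0"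
  shows "\<exists>Gs. good_list n Gs \<and> stellar_step facets (generated (set Fs)) (generated (set Gs)) \<and>
    cost n {} Gs < cost n {} Fs"
proof -
  obtain pre \<sigma> post e where split: "Fs = pre @ \<sigma> # post" and e: "e \<in> ext (set pre) \<sigma>"
    using assms(3) by (rule cost_nonzero_split)
  have \<sigma>: "\<sigma> \<in> set Fs" "finite \<sigma>" "card \<sigma> = n + 1" using good split by (auto simp: good_list_def)
  obtain v where v: "v \<notin> \<Union>(set Fs)" "v \<notin> \<Union>(generated (set Fs))" using fresh_vertex[OF inf good] .
  have "\<exists>Gs. good_list n Gs \<and> generated (set Gs) = stellar (generated (set Fs)) \<sigma> v \<and>
    cost n {} Gs < cost n {} Fs"
  proof (rule subdivide_good_list[OF good _ \<sigma>(2) _ v(1)])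
    show "along (\<lambda>P \<sigma>'. \<sigma> \<subseteq> \<sigma>' \<longrightarrow> ext P \<sigma>' = {} \<or> ext P \<sigma>' \<inter> \<sigma> \<noteq> {}) {} Fs"
      unfolding along_iff_split
    proof (intro allI impI)
      fix pre' \<sigma>' post' assume "Fs = pre' @ \<sigma>' # post'" "\<sigma> \<subseteq> \<sigma>'"
      then have "\<sigma>' = \<sigma>" using good_list_antichain[OF good \<sigma>(1), of \<sigma>'] by simp
      then show "ext ({} \<union> set pre') \<sigma>' = {} \<or> ext ({} \<union> set pre') \<sigma>' \<inter> \<sigma> \<noteq> {}"
        by (auto simp: ext_def)
    qed
    show "\<not> along (\<lambda>P \<sigma>'. \<sigma> \<subseteq> \<sigma>' \<longrightarrow> ext P \<sigma>' = {}) {} Fs"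
      using e by (auto simp: split along_append)
  qed (use \<sigma> in auto)
  moreover have "\<sigma> \<in> facets (generated (set Fs))" using \<sigma> facets_generated[OF good] by simp
  ultimately show ?thesis using v(2) unfolding stellar_step_def by metis
qed

text \<open>Let \<open>F\<close> be an earlier facet containing \<open>e\<close> and the least face
  of \<sigma>, and drop from \<sigma> a vertex \<open>x\<close> outside \<open>F\<close>. The ridge
  contains \<open>e\<close>, which settles \<sigma>. Since \<open>x\<close> is not in
  \<open>opp\<close>, no earlier facet contains the ridge. For a later facet containing it, \<sigma>
  is an earlier neighbour, so the vertex opposite to the ridge lies in its \<open>opp\<close> and
  its \<open>ext\<close> is contained in the ridge.\<close>

lemma ridge_step:
  assumes inf: "infinite (UNIV :: 'a set)" and good: "good_list n (Fs :: 'a set list)" and "cost n {} Fs \<noteq> 0"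
  shows "\<exists>Gs. good_list n Gs \<and> stellar_step (ridges n) (generated (set Fs)) (generated (set Gs)) \<and>
    cost n {} Gs < cost n {} Fs"
proof -
  obtain pre \<sigma> post e where split: "Fs = pre @ \<sigma> # post" and e: "e \<in> ext (set pre) \<sigma>"
    using assms(3) by (rule cost_nonzero_split)
  have dist: "distinct Fs" using good by (simp add: good_list_def)
  have \<sigma>: "\<sigma> \<in> set Fs" "finite \<sigma>" "card \<sigma> = n + 1" using good split by (auto simp: good_list_def)
  obtain v where v: "v \<notin> \<Union>(set Fs)" "v \<notin> \<Union>(generated (set Fs))" using fresh_vertex[OF inf good] .
  obtain F where e': "e \<in> \<sigma>" and F: "F \<in> set pre" "insert e (opp (set pre) \<sigma>) \<subseteq> F"
    using e by (elim extE)
  have "\<not> \<sigma> \<subseteq> F" using F dist split good_list_antichain[OF good \<sigma>(1), of F] by auto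
  then obtain x where x: "x \<in> \<sigma>" "x \<notin> F" by blast
  have x': "x \<notin> opp (set pre) \<sigma>" "x \<noteq> e" using x F by auto
  let ?\<tau> = "\<sigma> - {x}"
  have \<tau>: "e \<in> ?\<tau>" "finite ?\<tau>" "card ?\<tau> = n" using \<sigma> x x' e' by auto
  have "\<exists>Gs. good_list n Gs \<and> generated (set Gs) = stellar (generated (set Fs)) ?\<tau> v \<and>
    cost n {} Gs < cost n {} Fs"
  proof (rule subdivide_good_list[OF good _ \<tau>(2) _ v(1)])
    show "along (\<lambda>P \<sigma>'. ?\<tau> \<subseteq> \<sigma>' \<longrightarrow> ext P \<sigma>' = {} \<or> ext P \<sigma>' \<inter> ?\<tau> \<noteq> {}) {} Fs"
      unfolding along_iff_split
    proof (intro allI impI)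
      fix pre' \<sigma>' post' assume split': "Fs = pre' @ \<sigma>' # post'" and sub: "?\<tau> \<subseteq> \<sigma>'"
      have \<sigma>': "\<sigma>' \<in> set Fs" "finite \<sigma>'" "card \<sigma>' = n + 1" using good split' by (auto simp: good_list_def)
      from dist split split' show "ext ({} \<union> set pre') \<sigma>' = {} \<or> ext ({} \<union> set pre') \<sigma>' \<inter> ?\<tau> \<noteq> {}"
      proof (cases rule: split_cases)
        case 1
        then have "e \<in> ext ({} \<union> set pre') \<sigma>' \<inter> ?\<tau>" using e \<tau> by simp
        then show ?thesis by blast
      next
        case 2
        have "\<sigma> \<noteq> \<sigma>'" using 2 dist split' by auto
        then have "\<not> \<sigma>' \<subseteq> \<sigma>" using good_list_antichain[OF good \<sigma>'(1) \<sigma>(1)] by blast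
        then obtain y where y: "y \<in> \<sigma>'" "y \<notin> \<sigma>" by blast
        then have \<tau>_eq: "?\<tau> = \<sigma>' - {y}" using codim1_eq[OF \<sigma>'(2,3) sub] \<tau>(3) by blast
        then have "y \<in> opp (set pre') \<sigma>'" using y 2 by (intro oppI[of y _ \<sigma>]) auto
        then have "ext (set pre') \<sigma>' \<subseteq> ?\<tau>" unfolding \<tau>_eq by (auto simp: ext_def)
        then show ?thesis by auto
      next
        case 3
        then have "x \<in> opp (set pre) \<sigma>" using x sub by (intro oppI[of x _ \<sigma>']) auto
        then show ?thesis using x' by blast
      qed
    qed
    show "\<not> along (\<lambda>P \<sigma>'. ?\<tau> \<subseteq> \<sigma>' \<longrightarrow> ext P \<sigma>' = {}) {} Fs"
      using e by (auto simp: split along_append)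
  qed (use \<tau> in auto)
  moreover have "?\<tau> \<in> ridges n (generated (set Fs))"
    using \<sigma>(1) \<tau> generatedI[of \<sigma> "set Fs" ?\<tau>] by (auto simp: ridges_def)
  ultimately show ?thesis using v(2) unfolding stellar_step_def by metis
qed

lemma reach_cost_0:
  assumes step: "\<And>Fs. good_list n Fs \<Longrightarrow> cost n {} Fs \<noteq> 0 \<Longrightarrow>
      \<exists>Gs. good_list n Gs \<and> stellar_step \<Phi> (generated (set Fs)) (generated (set Gs)) \<and>
        cost n {} Gs < cost n {} Fs"
    and "good_list n Fs"
  shows "\<exists>Gs. good_list n Gs \<and> (stellar_step \<Phi>)\<^sup>*\<^sup>* (generated (set Fs)) (generated (set Gs)) \<and> cost n {} Gs = 0"
  using assms(2)
proof (induction "cost n {} Fs" arbitrary: Fs rule: less_induct)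
  case less
  show ?case
  proof (cases "cost n {} Fs = 0")
    case True
    then show ?thesis using less.prems by blast
  next
    case False
    then obtain Gs where Gs: "good_list n Gs"
      "stellar_step \<Phi> (generated (set Fs)) (generated (set Gs))" "cost n {} Gs < cost n {} Fs"
      using step less.prems by blast
    then show ?thesis using less.hyps[OF Gs(3,1)] by (meson converse_rtranclp_into_rtranclp)
  qed
qed

lemma last_open:
  assumes "pure_list n Fs" "Fs \<noteq> []"
    and ridge: "\<And>x. x \<in> last Fs \<Longrightarrow> \<exists>F\<in>set Fs. F \<noteq> last Fs \<and> last Fs - {x} \<subseteq> F"
  shows "\<exists>p<length Fs. open_simplex (deprived (Fs ! p) (set (take p Fs)))"
proof -
  interpret pure_list n Fs by fact
  let ?p = "length Fs - 1"
  have p: "?p < length Fs" "last Fs = Fs ! ?p" "take ?p Fs = butlast Fs"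
    using assms(2) by (auto simp: last_conv_nth butlast_conv_take)
  have "Fs ! ?p \<subseteq> opp (set (take ?p Fs)) (Fs ! ?p)"
  proof
    fix x assume x: "x \<in> Fs ! ?p"
    then obtain F where F: "F \<in> set Fs" "F \<noteq> last Fs" "last Fs - {x} \<subseteq> F"
      using ridge[of x] p by auto
    have "set Fs = insert (last Fs) (set (butlast Fs))"
      using assms(2) by (metis append_butlast_last_id list.set(2) rotate1.simps(2) set_rotate1)
    then have "F \<in> set (take ?p Fs)" using F unfolding p(3) by blast
    then show "x \<in> opp (set (take ?p Fs)) (Fs ! ?p)" using F x p by (intro oppI[of x _ F]) auto
  qed
  then have "opp (set (take ?p Fs)) (Fs ! ?p) = Fs ! ?p"
    by (intro equalityI opp_subset)
  then show ?thesis using open_tile[OF p(1)] p(1) by blast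
qed

lemma good_list_conn:
  assumes "along (\<lambda>P \<sigma>. P = {} \<or> opp P \<sigma> \<noteq> {}) {} Fs" "0 < p" "p < length Fs"
  shows "opp (set (take p Fs)) (Fs ! p) \<noteq> {}"
proof -
  have "set (take p Fs) = {} \<or> opp (set (take p Fs)) (Fs ! p) \<noteq> {}"
    using assms(1)[unfolded along_iff_nth, rule_format, OF assms(3)] .
  moreover have "set (take p Fs) \<noteq> {}" using assms by auto
  ultimately show ?thesis by simp
qed

lemma good_list_h_shelling:
  assumes good: "good_list n Fs" and n: "0 < n" and cost: "cost n {} Fs = 0"
  shows "carries_shelling h_tile (generated (set Fs))"
proof -
  interpret pure_list n Fs using good by unfold_locales (auto simp: good_list_def)
  have conn: "along (\<lambda>P \<sigma>. P = {} \<or> opp P \<sigma> \<noteq> {}) {} Fs" using good by (simp add: good_list_def)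
  have ext: "along (\<lambda>P \<sigma>. ext P \<sigma> = {}) {} Fs"
    using cost_0[OF cost] good by (auto simp: good_list_def)
  show ?thesis
  proof (rule carries_shelling_generated)
    show "Fs \<noteq> []" using good by (simp add: good_list_def)
    fix p assume p: "p < length Fs"
    show "\<exists>k. h_tile (Fs ! p) k (tile p)"
      using ext p before[OF p] facet_finite[of "Fs ! p"] facet_nonempty[of "Fs ! p"]
      by (intro ext_empty_h_tile) (auto simp: along_iff_nth)
    assume "0 < p"
    then show "0 < n \<and> opp (set (take p Fs)) (Fs ! p) \<noteq> {}"
      using n good_list_conn[OF conn] p by blast
  next
    show "\<exists>p<length Fs. open_simplex (tile p)"
      using good by (intro last_open[OF pure_list_axioms]) (auto simp: good_list_def)
  qed (rule h_tile_zero)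
qed

section \<open>Ordering the facets of a pseudo-manifold\<close>

lemma generated_facets:
  assumes "simplicial_cpx K"
  shows "generated (facets K) = K"
proof (intro equalityI subsetI)
  fix s assume "s \<in> generated (facets K)"
  then obtain F where "F \<in> facets K" "s \<subseteq> F" "s \<noteq> {}" by (elim generatedE)
  then show "s \<in> K" using assms unfolding simplicial_cpx_def facets_def by blast
next
  fix s assume s: "s \<in> K"
  have "finite K" using assms by (simp add: simplicial_cpx_def)
  then obtain F where F: "F \<in> K" "s \<subseteq> F" "\<And>G. G \<in> K \<Longrightarrow> F \<subseteq> G \<Longrightarrow> F = G"
    using finite_has_maximal2[OF _ s] by metis
  then have "F \<in> facets K" by (auto simp: facets_def)
  moreover have "s \<noteq> {}" using assms s by (auto simp: simplicial_cpx_def)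
  ultimately show "s \<in> generated (facets K)" using F by (intro generatedI)
qed

text \<open>A list of maximal length exhausts the facets: on a path of adjacent facets leaving it,
  the first facet outside could still be appended.\<close>

lemma good_list_ex:
  assumes cpm: "closed_pseudo_manifold n K" and conn: "strongly_connected n K" and n: "0 < n"
  obtains Fs where "good_list n Fs" "set Fs = facets K"
proof -
  have cpx: "simplicial_cpx K" "K \<noteq> {}" using cpm by (auto simp: closed_pseudo_manifold_def)
  have fin: "finite (facets K)" using cpx by (auto simp: simplicial_cpx_def facets_def)
  have card: "finite F" "card F = n + 1" if "F \<in> facets K" for F
    using cpm that by (auto simp: closed_pseudo_manifold_def simplicial_cpx_def facets_def)
  define C where "C Fs \<longleftrightarrow> Fs \<noteq> [] \<and> distinct Fs \<and> set Fs \<subseteq> facets K \<and>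
    along (\<lambda>P \<sigma>. P = {} \<or> opp P \<sigma> \<noteq> {}) {} Fs" for Fs
  have "generated (facets K) \<noteq> {}" using generated_facets[OF cpx(1)] cpx(2) by simp
  then obtain \<sigma>0 where "\<sigma>0 \<in> facets K" by (auto simp: generated_def)
  then have "C [\<sigma>0]" by (simp add: C_def)
  moreover have "\<forall>Fs. C Fs \<longrightarrow> length Fs < Suc (card (facets K))"
    unfolding C_def less_Suc_eq_le using fin by (metis card_mono distinct_card)
  ultimately have "\<exists>Fs. C Fs \<and> (\<forall>Gs. C Gs \<longrightarrow> length Gs \<le> length Fs)"
    by (rule ex_has_greatest_nat)
  then obtain Fs where Fs: "C Fs" and max: "\<And>Gs. C Gs \<Longrightarrow> length Gs \<le> length Fs"
    by blast
  have "facets K \<subseteq> set Fs"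
  proof
    fix \<tau> assume \<tau>: "\<tau> \<in> facets K"
    obtain \<sigma> where \<sigma>: "\<sigma> \<in> set Fs" "\<sigma> \<in> facets K" using Fs by (cases Fs) (auto simp: C_def)
    have "(\<lambda>\<alpha> \<beta>. \<alpha> \<in> facets K \<and> \<beta> \<in> facets K \<and> \<alpha> \<inter> \<beta> \<in> ridges n K)\<^sup>*\<^sup>* \<sigma> \<tau>"
      using conn \<sigma> \<tau> by (auto simp: strongly_connected_def)
    then show "\<tau> \<in> set Fs"
    proof (induction rule: rtranclp_induct)
      case (step \<alpha> \<beta>)
      show ?case
      proof (rule ccontr)
        assume \<beta>: "\<beta> \<notin> set Fs"
        have r: "card (\<alpha> \<inter> \<beta>) = n" "\<beta> \<in> facets K" using step by (auto simp: ridges_def)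
        then obtain x where x: "x \<in> \<beta>" "x \<notin> \<alpha> \<inter> \<beta>"
          using card[of \<beta>] by (metis Suc_eq_plus1 Int_lower2 n_not_Suc_n subsetI subset_antisym)
        then have "\<alpha> \<inter> \<beta> = \<beta> - {x}" using r card[of \<beta>] by (intro codim1_eq) auto
        then have "x \<in> opp (set Fs) \<beta>" using x step.IH by (intro oppI[of x _ \<alpha>]) auto
        then have "C (Fs @ [\<beta>])" using Fs \<beta> r by (auto simp: C_def along_append)
        then show False using max by fastforce
      qed
    qed (rule \<sigma>(1))
  qed
  then have set_Fs: "set Fs = facets K" using Fs by (auto simp: C_def)
  have "\<exists>F\<in>set Fs. F \<noteq> \<sigma> \<and> \<sigma> - {x} \<subseteq> F" if \<sigma>: "\<sigma> \<in> set Fs" "x \<in> \<sigma>" for \<sigma> x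
  proof -
    have \<sigma>': "\<sigma> \<in> facets K" "\<sigma> \<in> K" using \<sigma> set_Fs by (auto simp: facets_def)
    have c: "card (\<sigma> - {x}) = n" using card[OF \<sigma>'(1)] \<sigma> by simp
    \<comment> \<open>The empty simplex is not in \<open>K\<close>, so the condition on ridges can
      be applied only in positive dimension.\<close>
    then have "\<sigma> - {x} \<noteq> {}" using n by force
    moreover from this have "\<sigma> - {x} \<in> K"
      using cpx(1)[unfolded simplicial_cpx_def] \<sigma>'(2) by (metis Diff_subset)
    ultimately have "\<sigma> - {x} \<in> ridges n K" using c by (simp add: ridges_def)
    then have "card {F \<in> facets K. \<sigma> - {x} \<subseteq> F} = 2" using cpm by (auto simp: closed_pseudo_manifold_def)
    then have "\<not> {F \<in> facets K. \<sigma> - {x} \<subseteq> F} \<subseteq> {\<sigma>}"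
      using card_mono[of "{\<sigma>}" "{F \<in> facets K. \<sigma> - {x} \<subseteq> F}"] by auto
    then show ?thesis unfolding set_Fs by auto
  qed
  then have "good_list n Fs" using Fs card set_Fs by (auto simp: good_list_def C_def)
  then show thesis using that set_Fs by blast
qed

lemma good_list_image:
  assumes "inj f" "good_list n Fs"
  shows "good_list n (map (image f) Fs)"
  unfolding good_list_def
proof (intro conjI ballI)
  show "map (image f) Fs \<noteq> []" using assms by (auto simp: good_list_def)
  show "distinct (map (image f) Fs)"
    using assms inj_on_subset[OF inj_on_image_Pow[of f UNIV]] by (auto simp: good_list_def distinct_map)
  show "along (\<lambda>P \<sigma>. P = {} \<or> opp P \<sigma> \<noteq> {}) {} (map (image f) Fs)"
    unfolding along_iff_split
  proof (intro allI impI)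
    fix pre x post assume "map (image f) Fs = pre @ x # post"
    then obtain pre' \<sigma> post' where split: "Fs = pre' @ \<sigma> # post'" "pre = map (image f) pre'" "x = f ` \<sigma>"
      unfolding map_eq_append_conv map_eq_Cons_conv by blast
    have "set pre' = {} \<or> opp (set pre') \<sigma> \<noteq> {}"
      using assms(2) split(1) by (simp add: good_list_def along_append)
    then show "{} \<union> set pre = {} \<or> opp ({} \<union> set pre) x \<noteq> {}"
    proof
      assume "opp (set pre') \<sigma> \<noteq> {}"
      then obtain w F where w: "w \<in> \<sigma>" "F \<in> set pre'" "\<sigma> - {w} \<subseteq> F" by (auto simp: opp_def)
      then have "f w \<in> opp ({} \<union> set pre) x" using split by (intro oppI[of _ _ "f ` F"]) auto
      then show ?thesis by blast
    qed (use split in simp)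
  qed
  fix G assume "G \<in> set (map (image f) Fs)"
  then obtain F where F: "F \<in> set Fs" "G = f ` F" by auto
  then show "finite G" "card G = n + 1"
    using assms card_image[OF inj_on_subset[OF assms(1)], of F] by (auto simp: good_list_def)
  fix x assume "x \<in> G"
  then obtain y where y: "y \<in> F" "x = f y" using F by blast
  then obtain H where H: "H \<in> set Fs" "H \<noteq> F" "F - {y} \<subseteq> H"
    using assms(2) F(1) unfolding good_list_def by metis
  then have "f ` H \<noteq> G" "G - {x} \<subseteq> f ` H" using F y assms(1) by (auto simp: inj_image_eq_iff)
  then show "\<exists>F\<in>set (map (image f) Fs). F \<noteq> G \<and> G - {x} \<subseteq> F" using H by auto
qed

lemma fresh_copy_generated: "fresh_copy (generated \<F>) = generated (image Inl ` \<F>)"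
proof (intro equalityI subsetI)
  fix s assume "s \<in> fresh_copy (generated \<F>)"
  then obtain t F where "s = Inl ` t" "F \<in> \<F>" "t \<subseteq> F" "t \<noteq> {}"
    by (auto simp: fresh_copy_def generated_def)
  then show "s \<in> generated (image Inl ` \<F>)" by (intro generatedI[of "Inl ` F"]) auto
next
  fix s :: "('a + nat) set" assume "s \<in> generated (image Inl ` \<F>)"
  then obtain F where F: "F \<in> \<F>" "s \<subseteq> Inl ` F" "s \<noteq> {}" by (auto simp: generated_def)
  then obtain t where "t \<subseteq> F" "s = Inl ` t" by (auto simp: subset_image_iff)
  then show "s \<in> fresh_copy (generated \<F>)" using F by (auto simp: fresh_copy_def generated_def)
qed

lemma stellar_h_shelling:
  fixes K :: "'a set set"
  assumes "closed_pseudo_manifold n K" "strongly_connected n K" "0 < n"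
  shows "\<exists>L. (stellar_step facets)\<^sup>*\<^sup>* (fresh_copy K) L \<and> carries_shelling h_tile L"
    and "\<exists>L. (stellar_step (ridges n))\<^sup>*\<^sup>* (fresh_copy K) L \<and> carries_shelling h_tile L"
proof -
  obtain Fs where Fs: "good_list n Fs" "set Fs = facets K" using good_list_ex[OF assms] .
  have "generated (set Fs) = K"
    using generated_facets[of K] assms(1) Fs by (simp add: closed_pseudo_manifold_def)
  then have copy: "fresh_copy K = generated (set (map (image Inl) Fs))"
    using fresh_copy_generated[of "set Fs"] by simp
  have good: "good_list n (map (image (Inl :: 'a \<Rightarrow> 'a + nat)) Fs)"
    using Fs(1) by (intro good_list_image) auto
  have inf: "infinite (UNIV :: ('a + nat) set)" by simp
  show "\<exists>L. (stellar_step facets)\<^sup>*\<^sup>* (fresh_copy K) L \<and> carries_shelling h_tile L"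
    unfolding copy using reach_cost_0[OF facet_step[OF inf] good] good_list_h_shelling[OF _ assms(3)] by blast
  show "\<exists>L. (stellar_step (ridges n))\<^sup>*\<^sup>* (fresh_copy K) L \<and> carries_shelling h_tile L"
    unfolding copy using reach_cost_0[OF ridge_step[OF inf] good] good_list_h_shelling[OF _ assms(3)] by blast
qed

section \<open>Barycentric subdivision\<close>

text \<open>A chamber of \<open>Sd K\<close>, encoded by the order in which the vertices of a facet
  are added. The lengths start at 1 because the empty simplex is not a vertex of
  \<open>Sd K\<close>.\<close>

definition flag :: "'a list \<Rightarrow> 'a set set" where
  "flag xs = (\<lambda>i. set (take i xs)) ` {1..length xs}"

lemma flagI: "1 \<le> i \<Longrightarrow> i \<le> length xs \<Longrightarrow> set (take i xs) \<in> flag xs"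
  by (auto simp: flag_def)

lemma flagE:
  assumes "s \<in> flag xs"
  obtains i where "1 \<le> i" "i \<le> length xs" "s = set (take i xs)"
  using assms by (auto simp: flag_def)

lemma card_set_take: "distinct xs \<Longrightarrow> i \<le> length xs \<Longrightarrow> card (set (take i xs)) = i"
  by (simp add: distinct_card)

lemma set_take_eq_iff:
  "distinct xs \<Longrightarrow> i \<le> length xs \<Longrightarrow> j \<le> length xs \<Longrightarrow> set (take i xs) = set (take j xs) \<longleftrightarrow> i = j"
  using card_set_take by metis

lemma flag_card:
  assumes "distinct xs" "s \<in> flag xs"
  shows "s = set (take (card s) xs)"
  using assms by (metis flagE card_set_take)

lemma card_flag: "distinct xs \<Longrightarrow> card (flag xs) = length xs"
  unfolding flag_def by (subst card_image) (auto simp: inj_on_def set_take_eq_iff)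

lemma flag_subset: "s \<in> flag xs \<Longrightarrow> s \<subseteq> set xs"
  by (auto simp: flag_def dest: in_set_takeD)

lemma flag_nonempty_elem: "s \<in> flag xs \<Longrightarrow> s \<noteq> {}"
  by (auto simp: flag_def)

lemma set_in_flag: "xs \<noteq> [] \<Longrightarrow> set xs \<in> flag xs"
  using flagI[of "length xs" xs] by (simp add: Suc_le_eq)

lemma flag_total: "s \<in> flag xs \<Longrightarrow> t \<in> flag xs \<Longrightarrow> s \<subseteq> t \<or> t \<subseteq> s"
  using set_take_subset_set_take by (metis flagE nat_le_linear)

text \<open>This moves a chamber into another facet \<open>F\<close> that contains its first
  \<open>k\<close> vertices; the two flags then share their first \<open>k\<close> members.\<close>

lemma extend_prefix:
  assumes "distinct xs" "finite F" "set (take k xs) \<subseteq> F" "k \<le> length xs"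
  obtains ys where "distinct ys" "set ys = F" "take k ys = take k xs"
proof -
  obtain zs where "distinct zs" "set zs = F - set (take k xs)"
    using finite_distinct_list assms(2) by (metis finite_Diff)
  then show thesis using that[of "take k xs @ zs"] assms by auto
qed

lemma flag_common_prefix:
  assumes "take k ys = take k xs" "1 \<le> i" "i \<le> k" "k \<le> length xs"
  shows "set (take i xs) \<in> flag ys"
proof -
  have "length (take k ys) = k" using assms by simp
  then have "i \<le> length ys" using assms(3) by simp
  moreover have "take i ys = take i xs" using assms by (metis min.absorb1 take_take)
  ultimately show ?thesis using flagI[of i ys] assms by simp
qed

text \<open>Enumerate the largest member of the chain compatibly with the smaller ones, then append
  the remaining vertices of \<sigma>.\<close>

lemma chain_in_flag:
  assumes "finite c" "finite \<sigma>" "\<And>s. s \<in> c \<Longrightarrow> s \<subseteq> \<sigma> \<and> s \<noteq> {}"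
    and "\<And>s t. s \<in> c \<Longrightarrow> t \<in> c \<Longrightarrow> s \<subseteq> t \<or> t \<subseteq> s"
  shows "\<exists>xs. distinct xs \<and> set xs = \<sigma> \<and> c \<subseteq> flag xs"
  using assms
proof (induction "card c" arbitrary: c \<sigma> rule: less_induct)
  case less
  show ?case
  proof (cases "c = {}")
    case True
    then show ?thesis using finite_distinct_list[OF less.prems(2)] by auto
  next
    case False
    then obtain m where m: "m \<in> c" "\<And>s. s \<in> c \<Longrightarrow> m \<subseteq> s \<Longrightarrow> m = s"
      using finite_has_maximal[OF less.prems(1)] by metis
    then have max: "s \<subseteq> m" if "s \<in> c" for s using less.prems(4)[OF that m(1)] that by blast
    have "card (c - {m}) < card c" using less.prems(1) m(1) by (rule card_Diff1_less)
    moreover have "finite m" using m(1) less.prems(2,3) finite_subset by blast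
    ultimately have "\<exists>xs. distinct xs \<and> set xs = m \<and> c - {m} \<subseteq> flag xs"
      using less.prems max by (intro less.hyps) auto
    then obtain xs where xs: "distinct xs" "set xs = m" "c - {m} \<subseteq> flag xs" by blast
    then obtain ys where ys: "distinct ys" "set ys = \<sigma>" "take (length xs) ys = take (length xs) xs"
      using extend_prefix[of xs \<sigma> "length xs"] less.prems m by auto
    have "xs \<noteq> []" using xs(2) less.prems(3)[OF m(1)] by auto
    have "c \<subseteq> flag xs" using xs set_in_flag[OF \<open>xs \<noteq> []\<close>] by auto
    also have "flag xs \<subseteq> flag ys"
    proof
      fix s assume "s \<in> flag xs"
      then obtain i where "1 \<le> i" "i \<le> length xs" "s = set (take i xs)" by (elim flagE)
      then show "s \<in> flag ys" using flag_common_prefix[OF ys(3)] by simp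
    qed
    finally show ?thesis using ys by blast
  qed
qed

lemma Sd_generated:
  assumes cpx: "simplicial_cpx K"
  shows "Sd K = generated (flag ` {xs. distinct xs \<and> set xs \<in> facets K})"
proof (intro equalityI subsetI)
  fix c assume c: "c \<in> Sd K"
  then have "c \<noteq> {}" "c \<subseteq> K" and chain: "\<And>s t. s \<in> c \<Longrightarrow> t \<in> c \<Longrightarrow> s \<subseteq> t \<or> t \<subseteq> s"
    by (auto simp: Sd_def subset.chain_def)
  have finK: "finite K" "\<And>s. s \<in> K \<Longrightarrow> finite s \<and> s \<noteq> {}" using cpx by (auto simp: simplicial_cpx_def)
  then have fin: "finite c" using \<open>c \<subseteq> K\<close> finite_subset by blast
  obtain m where m: "m \<in> c" "\<And>s. s \<in> c \<Longrightarrow> m \<subseteq> s \<Longrightarrow> m = s"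
    using finite_has_maximal[OF fin \<open>c \<noteq> {}\<close>] by metis
  then have "m \<in> generated (facets K)" using generated_facets[OF cpx] \<open>c \<subseteq> K\<close> by auto
  then obtain F where F: "F \<in> facets K" "m \<subseteq> F" by (elim generatedE)
  have "s \<subseteq> F \<and> s \<noteq> {}" if "s \<in> c" for s
    using m(2)[OF that] chain[OF that m(1)] F(2) finK(2) \<open>c \<subseteq> K\<close> that by auto
  moreover have "finite F" using F finK by (simp add: facets_def)
  ultimately obtain xs where "distinct xs" "set xs = F" "c \<subseteq> flag xs"
    using chain_in_flag[OF fin _ _ chain] by metis
  then show "c \<in> generated (flag ` {xs. distinct xs \<and> set xs \<in> facets K})"
    using F \<open>c \<noteq> {}\<close> by (intro generatedI[of "flag xs"]) auto
next
  fix c assume "c \<in> generated (flag ` {xs. distinct xs \<and> set xs \<in> facets K})"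
  then obtain xs where xs: "distinct xs" "set xs \<in> K" "c \<subseteq> flag xs" "c \<noteq> {}"
    by (auto simp: generated_def facets_def)
  have "s \<in> K" if "s \<in> c" for s
    using cpx xs(2) flag_subset[of s xs] flag_nonempty_elem[of s xs] xs(3) that
    unfolding simplicial_cpx_def by blast
  moreover have "s \<subseteq> t \<or> t \<subseteq> s" if "s \<in> c" "t \<in> c" for s t
    using flag_total[of s xs t] xs(3) that by blast
  ultimately show "c \<in> Sd K" using xs(4) by (auto simp: Sd_def subset.chain_def)
qed

section \<open>Descents and the lexicographic order\<close>

lemma descent_between:
  fixes f :: "'a \<Rightarrow> nat"
  assumes "j \<le> m" "f (xs ! m) < f (xs ! j)"
  shows "\<exists>i. j \<le> i \<and> i < m \<and> f (xs ! Suc i) < f (xs ! i)"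
proof (rule ccontr)
  assume no: "\<nexists>i. j \<le> i \<and> i < m \<and> f (xs ! Suc i) < f (xs ! i)"
  have "k \<le> m \<Longrightarrow> f (xs ! j) \<le> f (xs ! k)" if "j \<le> k" for k
    using that
  proof (induction k rule: dec_induct)
    case (step k)
    then have "f (xs ! k) \<le> f (xs ! Suc k)" using no by (meson not_less Suc_le_lessD)
    then show ?case using step by simp
  qed simp
  then show False using assms by (meson leD order_refl)
qed

text \<open>At the first difference \<open>j\<close> the vertex \<open>ys ! j\<close> has the
  smaller label and occurs in \<open>xs\<close> at a later position \<open>m\<close>. Somewhere from
  \<open>j\<close> to \<open>m\<close> the labels of \<open>xs\<close> descend, and the prefix of
  \<open>xs\<close> ending there does not yet contain \<open>ys ! j\<close>, unlike the prefix of
  \<open>ys\<close> of the same length. An earlier chamber of the same facet thus meets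
  \<open>flag xs\<close> inside a ridge belonging to a descent.\<close>

lemma lex_descent:
  fixes f :: "'a \<Rightarrow> nat"
  assumes dist: "distinct xs" "distinct ys" and set: "set ys = set xs" and inj: "inj_on f (set xs)"
    and less: "map f ys < map f xs"
  obtains i where "Suc i < length xs" "f (xs ! Suc i) < f (xs ! i)" "set (take (Suc i) xs) \<notin> flag ys"
proof -
  have len: "length ys = length xs" using dist set by (metis distinct_card)
  have "(map f ys, map f xs) \<in> lexord {(u, v). u < v}" using less by (simp add: list_less_def)
  then obtain j where j: "j < length xs" "take j (map f ys) = take j (map f xs)" "map f ys ! j < map f xs ! j"
    using len by (auto simp: lexord_take_index_conv)
  have tk: "take j ys = take j xs"
  proof (rule map_inj_on[of f])
    show "map f (take j ys) = map f (take j xs)" using j(2) by (simp add: take_map)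
    show "inj_on f (set (take j ys) \<union> set (take j xs))"
      using inj set by (auto intro: inj_on_subset dest: in_set_takeD)
  qed
  have fj: "f (ys ! j) < f (xs ! j)" using j len by simp
  have "ys ! j \<in> set xs" using set len j(1) nth_mem by metis
  then obtain m where m: "m < length xs" "xs ! m = ys ! j" by (auto simp: in_set_conv_nth)
  have "j \<le> m"
  proof (rule ccontr)
    assume "\<not> j \<le> m"
    then have "xs ! m = ys ! m" using tk by (metis not_le nth_take)
    then show False using m dist(2) len j(1) \<open>\<not> j \<le> m\<close> by (simp add: nth_eq_iff_index_eq)
  qed
  then obtain i where i: "j \<le> i" "i < m" "f (xs ! Suc i) < f (xs ! i)"
    using descent_between[of j m f xs] fj m by auto
  have "set (take (Suc i) xs) \<notin> flag ys"
  proof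
    assume *: "set (take (Suc i) xs) \<in> flag ys"
    have "card (set (take (Suc i) xs)) = Suc i" using i(2) m(1) by (intro card_set_take dist) simp
    then have "set (take (Suc i) xs) = set (take (Suc i) ys)"
      using flag_card[OF dist(2) *] by simp
    moreover have "ys ! j \<in> set (take (Suc i) ys)" using i(1,2) m(1) len by (auto simp: in_set_conv_nth intro!: exI[of _ j])
    ultimately have "xs ! m \<in> set (take (Suc i) xs)" using m by simp
    then obtain l where "l < Suc i" "xs ! l = xs ! m" "l < length xs" by (auto simp: in_set_conv_nth)
    then have "l = m" using dist(1) m(1) nth_eq_iff_index_eq by blast
    then show False using \<open>l < Suc i\<close> i(2) by simp
  qed
  then show thesis using that[of i] i m by simp
qed

text \<open>For any injective labelling, the lexicographically larger of two different orders has a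
  member in its flag that the other flag lacks.\<close>

lemma flag_inj:
  assumes "distinct xs" "distinct ys" "flag xs = flag ys" "xs \<noteq> []" "ys \<noteq> []"
  shows "xs = ys"
proof (rule ccontr)
  assume ne: "xs \<noteq> ys"
  have set: "set xs = set ys" using set_in_flag[OF assms(4)] set_in_flag[OF assms(5)] flag_subset assms(3) by blast
  obtain f :: "'a \<Rightarrow> nat" where f: "inj_on f (set xs)"
    using finite_imp_inj_to_nat_seg[of "set xs"] by auto
  then have "map f xs \<noteq> map f ys" using ne set by (simp add: inj_on_map_eq_map)
  then consider "map f ys < map f xs" | "map f xs < map f ys" by (meson neqE)
  then show False
  proof cases
    case 1
    obtain i where "Suc i < length xs" "set (take (Suc i) xs) \<notin> flag ys"
      using lex_descent[OF assms(1,2) set[symmetric] f 1] .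
    then show False using flagI[of "Suc i" xs] assms(3) by simp
  next
    case 2
    obtain i where "Suc i < length ys" "set (take (Suc i) ys) \<notin> flag xs"
      using lex_descent[OF assms(2,1) set _ 2] f set by auto
    then show False using flagI[of "Suc i" ys] assms(3) by simp
  qed
qed

text \<open>Transposing the vertices at positions \<open>i\<close> and \<open>Suc i\<close> changes
  only the prefix of length \<open>Suc i\<close>. It yields the neighbour across that ridge within
  the same facet, which is lexicographically smaller if there is a descent.\<close>

lemma swap_flag:
  fixes xs :: "'a list"
  assumes "distinct xs" "Suc i < length xs"
  obtains zs where "distinct zs" "set zs = set xs" "flag xs - {set (take (Suc i) xs)} \<subseteq> flag zs" "zs \<noteq> xs"
    "\<And>f :: 'a \<Rightarrow> nat. f (xs ! Suc i) < f (xs ! i) \<Longrightarrow> map f zs < map f xs"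
proof -
  let ?as = "take i xs" and ?a = "xs ! i" and ?b = "xs ! Suc i" and ?cs = "drop (Suc (Suc i)) xs"
  have xs: "xs = ?as @ ?a # ?b # ?cs"
    using assms(2) by (metis Cons_nth_drop_Suc Suc_lessD append_take_drop_id)
  let ?zs = "?as @ ?b # ?a # ?cs"
  have len: "length ?as = i" using assms by simp
  have same: "set (take k xs) = set (take k ?zs)" if "k \<noteq> Suc i" for k
  proof (cases "k \<le> i")
    case True
    then show ?thesis using assms(2) by simp
  next
    case False
    then have "i + 2 \<le> k" using that by linarith
    then obtain l where "k = i + 2 + l" using le_Suc_ex by metis
    then have k: "k = i + Suc (Suc l)" by simp
    have "take k (?as @ ?a # ?b # ?cs) = ?as @ ?a # ?b # take l ?cs" using k assms(2) by simp
    moreover have "take k ?zs = ?as @ ?b # ?a # take l ?cs" using k assms(2) by simp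
    ultimately show ?thesis using arg_cong[OF xs, of "\<lambda>ys. set (take k ys)"] by auto
  qed
  have sub: "flag xs - {set (take (Suc i) xs)} \<subseteq> flag ?zs"
  proof
    fix s assume s: "s \<in> flag xs - {set (take (Suc i) xs)}"
    then obtain k where k: "1 \<le> k" "k \<le> length xs" "s = set (take k xs)" by (elim DiffE flagE)
    moreover have "k \<noteq> Suc i" using s k(3) by auto
    moreover have "length ?zs = length xs" using assms(2) by simp
    ultimately show "s \<in> flag ?zs" using same[of k] flagI[of k ?zs] by metis
  qed
  have d: "distinct (?as @ ?a # ?b # ?cs)" using assms(1) xs by simp
  have "set ?zs = set (?as @ ?a # ?b # ?cs)" by auto
  then have set: "set ?zs = set xs" using xs by simp
  have "distinct ?zs" using d by auto
  moreover have "?zs ! i \<noteq> ?a" using d len by (auto simp: nth_append)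
  then have "?zs \<noteq> xs" by metis
  moreover have "map f ?zs < map f xs" if "f ?b < f ?a" for f :: "'a \<Rightarrow> nat"
  proof -
    have "map f ?zs < map f (?as @ ?a # ?b # ?cs)"
      using that by (auto simp: list_less_def intro!: lexord_append_leftI)
    then show ?thesis using xs by simp
  qed
  ultimately show thesis using that[of ?zs] set sub by blast
qed

section \<open>Shelling the chambers\<close>

lemma sorted_by_key:
  fixes key :: "'a \<Rightarrow> 'b :: linorder"
  assumes "finite M" "inj_on key M"
  obtains XS where "distinct XS" "set XS = M"
    "\<And>p. p < length XS \<Longrightarrow> set (take p XS) = {y \<in> M. key y < key (XS ! p)}"
proof -
  obtain XS where XS: "set XS = M" "distinct XS" "sorted (map key XS)"
    using assms(1) by (metis finite_distinct_list distinct_sort set_sort sorted_sort_key)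
  have "distinct (map key XS)" using XS assms(2) by (simp add: distinct_map)
  then have less: "key (XS ! q) < key (XS ! p)" if "q < p" "p < length XS" for p q
    using sorted_nth_mono[OF XS(3), of q p] nth_eq_iff_index_eq[of "map key XS" q p] that by (simp add: le_less)
  have "set (take p XS) = {y \<in> M. key y < key (XS ! p)}" if p: "p < length XS" for p
  proof (intro equalityI subsetI)
    fix y assume "y \<in> set (take p XS)"
    then obtain q where "q < p" "y = XS ! q" using p by (auto simp: in_set_conv_nth)
    then show "y \<in> {y \<in> M. key y < key (XS ! p)}"
      using less[of q p] p XS(1) nth_mem[of q XS] by simp
  next
    fix y assume "y \<in> {y \<in> M. key y < key (XS ! p)}"
    then obtain q where q: "q < length XS" "y = XS ! q" "key (XS ! q) < key (XS ! p)"
      using XS(1) by (auto simp: in_set_conv_nth)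
    then have "q < p" using less[of p q] by (metis linorder_neqE_nat not_less_iff_gr_or_eq)
    then show "y \<in> set (take p XS)" using q p by (auto simp: in_set_conv_nth intro!: exI[of _ q])
  qed
  then show thesis using that XS by blast
qed

text \<open>In every facet but the first, \<open>lab_max\<close> gives the largest label to a vertex
  opposite to a ridge shared with an earlier facet. The chamber without descents adds this vertex
  last, so its first \<open>n\<close> vertices form that ridge.\<close>

locale chamber_order =
  fixes n :: nat and Fs :: "'a set list" and idx :: "'a set \<Rightarrow> nat" and lab :: "'a set \<Rightarrow> 'a \<Rightarrow> nat"
  assumes good: "good_list n Fs" and n: "0 < n"
    and idx_inj: "inj_on idx (set Fs)"
    and lab_inj: "\<sigma> \<in> set Fs \<Longrightarrow> inj_on (lab \<sigma>) \<sigma>"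
    and lab_max: "\<sigma> \<in> set Fs \<Longrightarrow> \<tau> \<in> set Fs \<Longrightarrow> idx \<tau> < idx \<sigma> \<Longrightarrow>
      \<exists>x\<in>\<sigma>. (\<forall>y\<in>\<sigma>. lab \<sigma> y \<le> lab \<sigma> x) \<and> (\<exists>F\<in>set Fs. idx F < idx \<sigma> \<and> \<sigma> - {x} \<subseteq> F)"
begin

definition "M = {xs. distinct xs \<and> set xs \<in> set Fs}"

definition key :: "'a list \<Rightarrow> nat list" where
  "key xs = idx (set xs) # map (lab (set xs)) xs"

definition earlier :: "'a list \<Rightarrow> 'a set set set" where
  "earlier xs = flag ` {ys \<in> M. key ys < key xs}"

lemma M: "xs \<in> M \<Longrightarrow> distinct xs" "xs \<in> M \<Longrightarrow> set xs \<in> set Fs" "xs \<in> M \<Longrightarrow> length xs = n + 1"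
  using good by (auto simp: M_def good_list_def distinct_card)

lemma facet: "F \<in> set Fs \<Longrightarrow> finite F" "F \<in> set Fs \<Longrightarrow> card F = n + 1"
  using good by (auto simp: good_list_def)

lemma flag_inj_M: "inj_on flag M"
proof (rule inj_onI)
  fix xs ys assume "xs \<in> M" "ys \<in> M" "flag xs = flag ys"
  then show "xs = ys" using M[of xs] M[of ys] by (intro flag_inj) auto
qed

lemma key_inj: "inj_on key M"
proof (rule inj_onI)
  fix xs ys assume xs: "xs \<in> M" and ys: "ys \<in> M" and eq: "key xs = key ys"
  then have "set xs = set ys" using idx_inj M by (auto simp: key_def inj_on_def)
  then show "xs = ys" using eq lab_inj[OF M(2)[OF xs]] by (simp add: key_def inj_on_map_eq_map)
qed

lemma finite_M: "finite M"
proof -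
  have "finite (\<Union>(set Fs))" using facet by auto
  then have "finite {xs. set xs \<subseteq> \<Union>(set Fs) \<and> length xs \<le> n + 1}" by (rule finite_lists_length_le)
  moreover have "M \<subseteq> {xs. set xs \<subseteq> \<Union>(set Fs) \<and> length xs \<le> n + 1}"
  proof
    fix xs assume "xs \<in> M"
    then show "xs \<in> {xs. set xs \<subseteq> \<Union>(set Fs) \<and> length xs \<le> n + 1}"
      using M(2,3)[of xs] by auto
  qed
  ultimately show ?thesis by (rule rev_finite_subset)
qed

lemma key_less:
  assumes "xs \<in> M" "ys \<in> M" "key ys < key xs"
  shows "idx (set ys) < idx (set xs) \<or> (set ys = set xs \<and> map (lab (set xs)) ys < map (lab (set xs)) xs)"
  using assms idx_inj M(2)[of xs] M(2)[of ys] by (auto simp: key_def inj_on_def)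

lemma descent_opp:
  assumes xs: "xs \<in> M" and i: "Suc i < length xs" "lab (set xs) (xs ! Suc i) < lab (set xs) (xs ! i)"
  shows "set (take (Suc i) xs) \<in> opp (earlier xs) (flag xs)"
proof -
  obtain zs where zs: "distinct zs" "set zs = set xs" "flag xs - {set (take (Suc i) xs)} \<subseteq> flag zs"
    "map (lab (set xs)) zs < map (lab (set xs)) xs"
    using swap_flag[OF M(1)[OF xs] i(1)] i(2) by metis
  have "zs \<in> M" "key zs < key xs" using zs M(2)[OF xs] by (auto simp: M_def key_def)
  then have "flag zs \<in> earlier xs" by (simp add: earlier_def)
  then show ?thesis using zs i flagI[of "Suc i" xs] by (intro oppI) auto
qed

text \<open>The index of the facet is compared before the labels, so every chamber of an earlier
  facet is earlier, in particular any that starts with the given prefix.\<close>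

lemma prefix_earlier:
  assumes xs: "xs \<in> M" and F: "F \<in> set Fs" "idx F < idx (set xs)" and k: "k \<le> length xs" "set (take k xs) \<subseteq> F"
  obtains G where "G \<in> earlier xs" "\<And>i. 1 \<le> i \<Longrightarrow> i \<le> k \<Longrightarrow> set (take i xs) \<in> G"
proof -
  obtain ys where ys: "distinct ys" "set ys = F" "take k ys = take k xs"
    using extend_prefix[OF M(1)[OF xs] facet(1)[OF F(1)] k(2,1)] .
  then have "ys \<in> M" "key ys < key xs" using F by (auto simp: M_def key_def)
  then have "flag ys \<in> earlier xs" by (simp add: earlier_def)
  then show thesis using that flag_common_prefix[OF ys(3) _ _ k(1)] by blast
qed

text \<open>A descent always provides a removed ridge. In a facet preceded by others, the vertex
  \<open>x\<close> with the largest label either is not the last one, so that the labels descend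
  after it, or is the last one; then all of the flag but \<open>set xs\<close> lies in a chamber of
  an earlier facet.\<close>

lemma opp_nonempty:
  assumes xs: "xs \<in> M" and ys: "ys \<in> M" "key ys < key xs"
  shows "opp (earlier xs) (flag xs) \<noteq> {}"
  using key_less[OF xs ys]
proof
  assume "set ys = set xs \<and> map (lab (set xs)) ys < map (lab (set xs)) xs"
  then obtain i where "Suc i < length xs" "lab (set xs) (xs ! Suc i) < lab (set xs) (xs ! i)"
    using lex_descent[OF M(1)[OF xs] M(1)[OF ys(1)] _ lab_inj[OF M(2)[OF xs]]] by metis
  then show ?thesis using descent_opp[OF xs] by blast
next
  assume "idx (set ys) < idx (set xs)"
  then obtain x F where x: "x \<in> set xs" "\<And>y. y \<in> set xs \<Longrightarrow> lab (set xs) y \<le> lab (set xs) x"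
    and F: "F \<in> set Fs" "idx F < idx (set xs)" "set xs - {x} \<subseteq> F"
    using lab_max[OF M(2)[OF xs] M(2)[OF ys(1)]] by blast
  obtain m where m: "m \<le> n" "xs ! m = x" using x(1) M(3)[OF xs] by (auto simp: in_set_conv_nth less_Suc_eq_le)
  show ?thesis
  proof (cases "m = n")
    case True
    have xs_eq: "xs = take n xs @ [x]" using M(3)[OF xs] m True by (metis Suc_eq_plus1 lessI take_Suc_conv_app_nth take_all_iff order_refl)
    then have "x \<notin> set (take n xs)" using M(1)[OF xs] by (metis distinct.simps(2) distinct_append not_distinct_conv_prefix append.right_neutral disjoint_iff list.set_intros(1))
    then have "set (take n xs) \<subseteq> F" using F(3) set_take_subset[of n xs] by blast
    then obtain G where G: "G \<in> earlier xs" "\<And>i. 1 \<le> i \<Longrightarrow> i \<le> n \<Longrightarrow> set (take i xs) \<in> G"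
      using prefix_earlier[OF xs F(1,2), of n] M(3)[OF xs] by auto
    have "flag xs - {set xs} \<subseteq> G"
    proof
      fix s assume "s \<in> flag xs - {set xs}"
      then obtain i where i: "1 \<le> i" "i \<le> length xs" "s = set (take i xs)" "s \<noteq> set xs"
        by (elim DiffE flagE) simp
      then have "i \<noteq> length xs" by auto
      then show "s \<in> G" using G(2)[of i] i M(3)[OF xs] by simp
    qed
    moreover have "xs \<noteq> []" using x(1) by auto
    ultimately have "set xs \<in> opp (earlier xs) (flag xs)"
      using G(1) set_in_flag[of xs] by (intro oppI[of _ _ G]) auto
    then show ?thesis by blast
  next
    case False
    then have "m < n" using m by simp
    have "xs ! n \<in> set xs" "xs ! n \<noteq> x"
      using M(1,3)[OF xs] m False by (auto simp: nth_eq_iff_index_eq)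
    then have "lab (set xs) (xs ! n) < lab (set xs) (xs ! m)"
      using x m lab_inj[OF M(2)[OF xs]] by (metis inj_onD le_neq_implies_less)
    then obtain i where "i < n" "lab (set xs) (xs ! Suc i) < lab (set xs) (xs ! i)"
      using descent_between[OF m(1)] by blast
    then show ?thesis using descent_opp[OF xs, of i] M(3)[OF xs] by auto
  qed
qed

text \<open>The additional face \<mu> consists of the members of the flag lying in earlier facets.
  An earlier chamber of the same facet misses the member at some descent, hence misses part of
  \<open>opp\<close>; so the chambers containing \<open>opp\<close> belong to earlier facets and
  meet the flag inside \<mu>.\<close>

lemma chamber_morse_tile:
  assumes xs: "xs \<in> M" and nsub: "\<And>F. F \<in> earlier xs \<Longrightarrow> finite F \<and> \<not> flag xs \<subseteq> F"
  shows "\<exists>k. morse_tile (flag xs) k (deprived (flag xs) (earlier xs))"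
proof -
  let ?\<mu> = "{s \<in> flag xs. \<exists>F\<in>set Fs. idx F < idx (set xs) \<and> s \<subseteq> F}"
  have card: "card (flag xs) = n + 1" using card_flag[OF M(1)[OF xs]] M(3)[OF xs] by simp
  show ?thesis
  proof (rule one_face_morse_tile)
    show "finite (flag xs)" by (simp add: flag_def)
    show "flag xs \<noteq> {}" using card by force
    show "?\<mu> \<subseteq> flag xs" by blast
    show "?\<mu> = {} \<or> (\<exists>G\<in>earlier xs. ?\<mu> \<subseteq> G)"
    proof (rule disjCI)
      assume "\<not> (\<exists>G\<in>earlier xs. ?\<mu> \<subseteq> G)"
      show "?\<mu> = {}"
      proof (rule ccontr)
        assume ne: "?\<mu> \<noteq> {}"
        have "finite ?\<mu>" by (simp add: flag_def)
        \<comment> \<open>The facet containing the largest member \<open>m\<close> contains all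
          smaller ones, so a single chamber of it covers \<mu>.\<close>
        then have "\<exists>m\<in>?\<mu>. \<forall>s\<in>?\<mu>. m \<subseteq> s \<longrightarrow> m = s" by (rule finite_has_maximal[OF _ ne])
        then obtain m where m: "m \<in> ?\<mu>" "\<forall>s\<in>?\<mu>. m \<subseteq> s \<longrightarrow> m = s" by (elim bexE)
        then obtain F where F: "F \<in> set Fs" "idx F < idx (set xs)" "m \<subseteq> F" by blast
        obtain k where k: "1 \<le> k" "k \<le> length xs" "m = set (take k xs)" using m(1) by (elim CollectE conjE flagE)
        obtain G where G: "G \<in> earlier xs" "\<And>i. 1 \<le> i \<Longrightarrow> i \<le> k \<Longrightarrow> set (take i xs) \<in> G"
          using prefix_earlier[OF xs F(1,2) k(2)] F(3) k(3) by blast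
        have "?\<mu> \<subseteq> G"
        proof
          fix s assume s: "s \<in> ?\<mu>"
          then obtain i where i: "1 \<le> i" "i \<le> length xs" "s = set (take i xs)" by (elim CollectE conjE flagE)
          have "i \<le> k"
          proof (rule ccontr)
            assume "\<not> i \<le> k"
            then have "m \<subseteq> s" using i k set_take_subset_set_take[of k i xs] by simp
            then have "m = s" using m(2)[rule_format, OF s] by simp
            then show False using \<open>\<not> i \<le> k\<close> i k set_take_eq_iff[OF M(1)[OF xs]] by simp
          qed
          then show "s \<in> G" using G i by simp
        qed
        then show False using G(1) \<open>\<not> (\<exists>G\<in>earlier xs. ?\<mu> \<subseteq> G)\<close> by blast
      qed
    qed
  next
    fix F assume F: "F \<in> earlier xs" "opp (earlier xs) (flag xs) \<subseteq> F"
    then obtain ys where ys: "ys \<in> M" "key ys < key xs" "F = flag ys" by (auto simp: earlier_def)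
    from key_less[OF xs ys(1,2)] show "flag xs \<inter> F \<subseteq> ?\<mu>"
    proof
      assume "idx (set ys) < idx (set xs)"
      then show ?thesis using ys M(2)[OF ys(1)] flag_subset[of _ ys] by auto
    next
      assume "set ys = set xs \<and> map (lab (set xs)) ys < map (lab (set xs)) xs"
      then obtain i where "Suc i < length xs" "lab (set xs) (xs ! Suc i) < lab (set xs) (xs ! i)"
        "set (take (Suc i) xs) \<notin> flag ys"
        using lex_descent[OF M(1)[OF xs] M(1)[OF ys(1)] _ lab_inj[OF M(2)[OF xs]]] by metis
      then show ?thesis using descent_opp[OF xs] F(2) ys(3) by blast
    qed
  qed (use nsub in auto)
qed

text \<open>Opposite to a proper prefix the neighbour is a transposition within the facet. Opposite
  to \<open>set xs\<close> the chamber keeps its first \<open>n\<close> vertices and crosses into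
  another facet that contains them.\<close>

lemma chamber_ridge:
  assumes xs: "xs \<in> M" and s: "s \<in> flag xs"
  shows "\<exists>ys\<in>M. flag ys \<noteq> flag xs \<and> flag xs - {s} \<subseteq> flag ys"
proof -
  obtain k where k: "1 \<le> k" "k \<le> length xs" "s = set (take k xs)" using s by (elim flagE)
  show ?thesis
  proof (cases "k = length xs")
    case False
    then obtain i where i: "k = Suc i" "Suc i < length xs" using k by (cases k) auto
    obtain zs where zs: "distinct zs" "set zs = set xs" "flag xs - {s} \<subseteq> flag zs" "zs \<noteq> xs"
      using swap_flag[OF M(1)[OF xs] i(2)] k(3) i(1) by metis
    then have "zs \<in> M" using M(2)[OF xs] by (simp add: M_def)
    moreover from this have "flag zs \<noteq> flag xs" using zs(4) flag_inj_M xs by (auto simp: inj_on_def)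
    ultimately show ?thesis using zs(3) by blast
  next
    case True
    then have s_eq: "s = set xs" using k by simp
    have len: "length xs = Suc n" using M(3)[OF xs] by simp
    have xs_eq: "xs = take n xs @ [xs ! n]" using len by (metis lessI take_Suc_conv_app_nth take_all_iff order_refl)
    have "distinct (take n xs @ [xs ! n])" using M(1)[OF xs] xs_eq by simp
    then have tk: "set (take n xs) \<subseteq> set xs - {xs ! n}" using set_take_subset[of n xs] by auto
    have "xs ! n \<in> set xs" using len by simp
    then obtain F where F: "F \<in> set Fs" "F \<noteq> set xs" "set xs - {xs ! n} \<subseteq> F"
      using good M(2)[OF xs] unfolding good_list_def by metis
    obtain ys where ys: "distinct ys" "set ys = F" "take n ys = take n xs"
      using extend_prefix[OF M(1)[OF xs] facet(1)[OF F(1)], of n] tk F(3) len by auto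
    have "ys \<in> M" using ys F by (simp add: M_def)
    have "flag xs - {s} \<subseteq> flag ys"
    proof
      fix t assume "t \<in> flag xs - {s}"
      then obtain i where i: "1 \<le> i" "i \<le> length xs" "t = set (take i xs)" "t \<noteq> set xs"
        using s_eq by (elim DiffE flagE) simp
      then have "i \<noteq> length xs" by auto
      then show "t \<in> flag ys" using flag_common_prefix[OF ys(3), of i] i len by simp
    qed
    moreover have "flag ys \<noteq> flag xs"
    proof
      assume "flag ys = flag xs"
      then have "ys = xs" using flag_inj_M xs \<open>ys \<in> M\<close> by (auto simp: inj_on_def)
      then show False using ys F by simp
    qed
    ultimately show ?thesis using \<open>ys \<in> M\<close> by blast
  qed
qed

lemma carries_morse_shelling: "carries_shelling morse_tile (generated (flag ` M))"
proof -
  obtain XS where XS: "distinct XS" "set XS = M"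
    "\<And>p. p < length XS \<Longrightarrow> set (take p XS) = {y \<in> M. key y < key (XS ! p)}"
    by (rule sorted_by_key[OF finite_M key_inj]) (rule that)
  let ?Cs = "map flag XS"
  have len: "length ?Cs = length XS" by simp
  have set_Cs: "set ?Cs = flag ` M" using XS by simp
  have pure: "pure_list n ?Cs"
  proof
    show "distinct ?Cs" using XS flag_inj_M by (simp add: distinct_map)
    show "card F = n + 1" if "F \<in> set ?Cs" for F
      using that XS(2) M(1,3) by (auto simp: card_flag)
  qed
  then interpret C: pure_list n ?Cs .
  have nth: "?Cs ! p = flag (XS ! p)" "XS ! p \<in> M" "set (take p ?Cs) = earlier (XS ! p)" if "p < length XS" for p
    using that XS(2,3) nth_mem[OF that] by (auto simp: take_map earlier_def)
  have ne: "?Cs \<noteq> []"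
  proof -
    obtain F where "F \<in> set Fs" using good by (cases Fs) (auto simp: good_list_def)
    then obtain xs where "distinct xs" "set xs = F" using finite_distinct_list facet by metis
    then have "xs \<in> M" using \<open>F \<in> set Fs\<close> by (simp add: M_def)
    then show ?thesis using XS(2) by auto
  qed
  have "carries_shelling morse_tile (generated (set ?Cs))"
  proof (rule C.carries_shelling_generated[OF ne])
    fix p assume "p < length ?Cs"
    then have p: "p < length XS" by simp
    show "\<exists>k. morse_tile (?Cs ! p) k (C.tile p)"
      unfolding nth[OF p] using C.before[of p] nth[OF p] p by (intro chamber_morse_tile) auto
    assume "0 < p"
    then have "XS ! 0 \<in> set (take p XS)" using p by (auto simp: in_set_conv_nth intro!: exI[of _ 0])
    then have "XS ! 0 \<in> M" "key (XS ! 0) < key (XS ! p)" using XS(3)[OF p] by auto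
    then show "0 < n \<and> opp (set (take p ?Cs)) (?Cs ! p) \<noteq> {}"
      unfolding nth[OF p] using n opp_nonempty[OF nth(2)[OF p]] by blast
  next
    show "\<exists>p<length ?Cs. open_simplex (C.tile p)"
    proof (rule last_open[OF pure ne])
      fix x assume x: "x \<in> last ?Cs"
      have "XS \<noteq> []" using ne by simp
      then have last: "last ?Cs = flag (last XS)" by (simp add: last_map)
      have "last XS \<in> M" using XS(2) last_in_set[OF \<open>XS \<noteq> []\<close>] by simp
      then show "\<exists>F\<in>set ?Cs. F \<noteq> last ?Cs \<and> last ?Cs - {x} \<subseteq> F"
        unfolding set_Cs last using chamber_ridge[of "last XS" x] x last by simp
    qed
  qed
  then show ?thesis using set_Cs by simp
qed

end

lemma Sd_morse_shelling:
  assumes cpm: "closed_pseudo_manifold n K" and conn: "strongly_connected n K" and n: "0 < n"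
  shows "carries_shelling morse_tile (Sd K)"
proof -
  obtain Fs where Fs: "good_list n Fs" "set Fs = facets K" using good_list_ex[OF assms] .
  have dist: "distinct Fs" and fin: "\<And>F. F \<in> set Fs \<Longrightarrow> finite F"
    and link: "along (\<lambda>P \<sigma>. P = {} \<or> opp P \<sigma> \<noteq> {}) {} Fs"
    using Fs(1) by (auto simp: good_list_def)
  define idx where "idx \<sigma> = (THE p. p < length Fs \<and> Fs ! p = \<sigma>)" for \<sigma>
  have idx: "idx (Fs ! p) = p" if "p < length Fs" for p
    unfolding idx_def using that dist by (intro the_equality) (auto simp: nth_eq_iff_index_eq)
  have idx': "idx F < length Fs" "Fs ! idx F = F" if "F \<in> set Fs" for F
    using that idx by (auto simp: in_set_conv_nth)
  have "\<exists>f :: 'a \<Rightarrow> nat. inj_on f \<sigma> \<and> (\<forall>\<tau>\<in>set Fs. idx \<tau> < idx \<sigma> \<longrightarrow>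
      (\<exists>x\<in>\<sigma>. (\<forall>y\<in>\<sigma>. f y \<le> f x) \<and> (\<exists>F\<in>set Fs. idx F < idx \<sigma> \<and> \<sigma> - {x} \<subseteq> F)))"
    if \<sigma>: "\<sigma> \<in> set Fs" for \<sigma>
  proof -
    obtain g :: "'a \<Rightarrow> nat" and N where g: "inj_on g \<sigma>" "g ` \<sigma> = {i. i < N}"
      using finite_imp_inj_to_nat_seg[OF fin[OF \<sigma>]] by auto
    have gN: "g y < N" if "y \<in> \<sigma>" for y using g(2) that by blast
    show ?thesis
    proof (cases "idx \<sigma> = 0")
      case True
      then show ?thesis using g by auto
    next
      case False
      then have "opp (set (take (idx \<sigma>) Fs)) (Fs ! idx \<sigma>) \<noteq> {}"
        using idx'(1)[OF \<sigma>] by (intro good_list_conn[OF link]) auto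
      then obtain x F where x: "x \<in> \<sigma>" "F \<in> set (take (idx \<sigma>) Fs)" "\<sigma> - {x} \<subseteq> F"
        using idx'(2)[OF \<sigma>] unfolding opp_def by auto
      then obtain q where "q < idx \<sigma>" "q < length Fs" "F = Fs ! q" by (auto simp: in_set_conv_nth)
      then have F: "F \<in> set Fs" "idx F < idx \<sigma>" using idx by auto
      \<comment> \<open>The value \<open>N\<close> lies above all values of \<open>g\<close> on
        \<sigma>, so \<open>x\<close> receives the largest label and injectivity is kept.\<close>
      have "inj_on (g(x := N)) \<sigma>" "\<forall>y\<in>\<sigma>. (g(x := N)) y \<le> (g(x := N)) x"
        using g(1) gN by (force simp: inj_on_def less_imp_le)+
      then show ?thesis using F x(1,3) by (intro exI[of _ "g(x := N)"]) auto
    qed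
  qed
  then obtain lab :: "'a set \<Rightarrow> 'a \<Rightarrow> nat" where lab: "\<And>\<sigma>. \<sigma> \<in> set Fs \<Longrightarrow> inj_on (lab \<sigma>) \<sigma> \<and>
      (\<forall>\<tau>\<in>set Fs. idx \<tau> < idx \<sigma> \<longrightarrow>
      (\<exists>x\<in>\<sigma>. (\<forall>y\<in>\<sigma>. lab \<sigma> y \<le> lab \<sigma> x) \<and> (\<exists>F\<in>set Fs. idx F < idx \<sigma> \<and> \<sigma> - {x} \<subseteq> F)))"
    by metis
  interpret chamber_order n Fs idx lab
  proof
    show "inj_on idx (set Fs)" using idx' by (metis inj_onI)
    show "inj_on (lab \<sigma>) \<sigma>" if "\<sigma> \<in> set Fs" for \<sigma> using lab[OF that] by simp
    show "\<exists>x\<in>\<sigma>. (\<forall>y\<in>\<sigma>. lab \<sigma> y \<le> lab \<sigma> x) \<and> (\<exists>F\<in>set Fs. idx F < idx \<sigma> \<and> \<sigma> - {x} \<subseteq> F)"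
      if "\<sigma> \<in> set Fs" "\<tau> \<in> set Fs" "idx \<tau> < idx \<sigma>" for \<sigma> \<tau>
      using lab[OF that(1), THEN conjunct2, rule_format, OF that(2,3)] .
  qed (fact Fs(1) n)+
  have "flag ` M = flag ` {xs. distinct xs \<and> set xs \<in> facets K}" by (simp add: M_def Fs)
  then show ?thesis using carries_morse_shelling Sd_generated[of K] cpm
    by (simp add: closed_pseudo_manifold_def)
qed

section \<open>Dimension zero\<close>

lemma point_shelling:
  assumes zero: "\<And>\<sigma> T. kind \<sigma> 0 T \<Longrightarrow> morse_tile \<sigma> 0 T"
    and basic: "\<And>\<sigma> k T. basic_tile \<sigma> k T \<Longrightarrow> kind \<sigma> k T"
  shows "carries_shelling kind {{a}}"
proof -
  interpret pure_list 0 "[{a}]" by unfold_locales auto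
  have tile: "tile 0 = realize {a}" by (simp add: deprived_def)
  have "generated {{a}} = {{a}}" by (auto simp: generated_def subset_singleton_iff)
  moreover have "carries_shelling kind (generated (set [{a}]))"
  proof (rule carries_shelling_generated)
    \<comment> \<open>The only proper face of a point is empty and has empty realization, so the
      single tile is at once a closed and an open simplex.\<close>
    show "\<exists>p<length [{a}]. open_simplex (tile p)"
      using tile by (auto simp: open_simplex_def deprived_def realize_def intro!: exI[of _ "{a}"])
    have "basic_tile {a} 0 (tile 0)"
      unfolding tile by (auto simp: basic_tile_def deprived_def intro!: exI[of _ "{}"])
    then show "\<exists>k. kind ([{a}] ! p) k (tile p)" if "p < length [{a}]" for p
      using basic that by auto
  qed (use zero in auto)
  ultimately show ?thesis by simp
qed

text \<open>A ridge would be the empty simplex, which is not in \<open>K\<close>; the adjacency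
  relation is therefore empty, and strong connectedness leaves a single facet.\<close>

lemma dimension_zero:
  assumes cpm: "closed_pseudo_manifold 0 K" and conn: "strongly_connected 0 K"
  obtains a where "K = {{a}}"
proof -
  have cpx: "simplicial_cpx K" "K \<noteq> {}" using cpm by (auto simp: closed_pseudo_manifold_def)
  have no_ridge: "ridges 0 K = {}" using cpx by (auto simp: ridges_def simplicial_cpx_def)
  obtain \<sigma> where \<sigma>: "\<sigma> \<in> facets K"
    using generated_facets[OF cpx(1)] cpx(2) by (force simp: generated_def)
  have "\<tau> = \<sigma>" if "\<tau> \<in> facets K" for \<tau>
  proof -
    have "(\<lambda>\<alpha> \<beta>. False)\<^sup>*\<^sup>* \<sigma> \<tau>"
      using conn \<sigma> that unfolding strongly_connected_def no_ridge by auto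
    then show ?thesis by (induction rule: rtranclp_induct) auto
  qed
  then have "facets K = {\<sigma>}" using \<sigma> by blast
  moreover obtain a where "\<sigma> = {a}"
    using cpm \<sigma> by (auto simp: closed_pseudo_manifold_def card_1_singleton_iff)
  ultimately have "K = generated {{a}}" using generated_facets[OF cpx(1)] by simp
  also have "\<dots> = {{a}}" by (auto simp: generated_def subset_singleton_iff)
  finally show thesis by (rule that)
qed

theorem theorem4p1:
  fixes K :: "'a set set" and n :: nat
  assumes "closed_pseudo_manifold n K" and "strongly_connected n K"
  shows "carries_shelling morse_tile (Sd K) \<and>
    (\<exists>L. (stellar_step facets)\<^sup>*\<^sup>* (fresh_copy K) L \<and> carries_shelling h_tile L) \<and>
    (\<exists>L. (stellar_step (ridges n))\<^sup>*\<^sup>* (fresh_copy K) L \<and> carries_shelling h_tile L) \<and>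
    (\<exists>L. (stellar_step (\<lambda>M. facets M \<union> ridges n M))\<^sup>*\<^sup>* (fresh_copy K) L \<and>
         carries_shelling h_tile L)"
proof (cases "n = 0")
  case True
  then obtain a where K: "K = {{a}}" using dimension_zero assms by metis
  have "Sd K = {{{a}}}" unfolding K Sd_def by (auto simp: subset.chain_def subset_singleton_iff)
  moreover have "fresh_copy K = {{Inl a}}" by (simp add: K fresh_copy_def)
  moreover have "carries_shelling morse_tile {{b}}" for b :: "'a set"
    by (rule point_shelling) (auto simp: basic_tile_def morse_tile_def)
  moreover have "carries_shelling h_tile {{b}}" for b :: "'a + nat"
    by (rule point_shelling) (auto simp: h_tile_zero h_tile_def)
  ultimately have "carries_shelling morse_tile (Sd K)" "carries_shelling h_tile (fresh_copy K)"
    by simp_all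
  \<comment> \<open>The point needs no subdivision, so the reflexive closure suffices.\<close>
  then show ?thesis by (intro conjI exI[of _ "fresh_copy K"]) auto
next
  case False
  have "stellar_step facets A B \<Longrightarrow> stellar_step (\<lambda>M. facets M \<union> ridges n M) A B"
    for A B :: "('a + nat) set set"
    unfolding stellar_step_def by blast
  then have "stellar_step facets \<le> (stellar_step (\<lambda>M. facets M \<union> ridges n M)
      :: ('a + nat) set set \<Rightarrow> ('a + nat) set set \<Rightarrow> bool)"
    by blast
  then have mono: "(stellar_step (\<lambda>M. facets M \<union> ridges n M))\<^sup>*\<^sup>* A B"
    if "(stellar_step facets)\<^sup>*\<^sup>* A B" for A B :: "('a + nat) set set"
    using that by (rule rtranclp_mono[THEN predicate2D])
  have n: "0 < n" using False by simp
  obtain L where L: "(stellar_step facets)\<^sup>*\<^sup>* (fresh_copy K) L" "carries_shelling h_tile L"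
    using stellar_h_shelling(1)[OF assms n] by blast
  show ?thesis
  proof (intro conjI)
    show "carries_shelling morse_tile (Sd K)" by (rule Sd_morse_shelling[OF assms n])
    show "\<exists>L. (stellar_step (ridges n))\<^sup>*\<^sup>* (fresh_copy K) L \<and> carries_shelling h_tile L"
      by (rule stellar_h_shelling(2)[OF assms n])
  qed (use L mono[OF L(1)] in blast)+
qed

end
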